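(* For every odd $m\ge 3$ and $i\in\{1,2\}$, the Boolean function associated with the Sperner system $\mathcal{S}^m_i$ is self-dual.
   Context: A Sperner system over a finite set $A$ is a set of subsets of $A$, called blocks, none of which is included in another. The Boolean function associated with a Sperner system $\mathcal A$ over an $n$-element set $A$ (identified with $\{1,\dots,n\}$ via a fixed bijection) is the $n$-ary function $\bigvee_{S\in\mathcal A}\bigwedge_{i\in S}x_i$ on $\{0,1\}$. A Boolean function $f\colon\{0,1\}^n\to\{0,1\}$ is self-dual if $f(\mathbf a)=\overline{f(\overline{\mathbf a})}$ for all $\mathbf a$, where $\overline0=1$, $\overline1=0$, applied componentwise to tuples. Let $[m]=\{1,\dots,m\}$. For each $n\in[m]$ let $n'$ be a new element (a primed copy of $n$), and $S'=\{n':n\in S\}$ for $S\subseteq[m]$. Let $E_m=[m]\cup[m]'$ ($2m$ elements). Addition in $[m]$ is modulo $m$ with result in $[m]$; $X+q=\{x+q:x\in X\}$. Let $\rho$ be the permutation of $E_m$ with $\rho(j)=j+1$, $\rho(j')=(j+1)'$; for a set system (set of subsets) $\mathcal A$ over $E_m$ let $\langle\mathcal A\rangle=\bigcup_{i\in[m]}\rho^i(\mathcal A)$, where $\rho^i(\mathcal A)=\{\rho^i(S):S\in\mathcal A\}$. For $J\subseteq[m]$ let $F^m_J=J\cup([m]\setminus J)'$; $\mathcal F^m_1=\{F^m_J:|J|\text{ odd}\}$, $\mathcal F^m_2=\{F^m_J:|J|\text{ even}\}$. For disjoint $X,Y\subseteq[m]$ let $[X|Y]$ be the set of all $J\subseteq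 E_m$ such that $|\{x,x'\}\cap J|=2$ for all $x\in X$, $|\{y,y'\}\cap J|=0$ for all $y\in Y$, and $|\{z,z'\}\cap J|=1$ for all $z\in[m]\setminus(X\cup Y)$. Let $\langle X|Y\rangle=\langle[X|Y]\rangle=\bigcup_{q\in[m]}[X+q|Y+q]$. Let $\Omega=\{\langle X|Y\rangle: X,Y\subseteq[m],\ |X|=|Y|,\ X\cap Y=\emptyset\}\setminus\{\langle\emptyset|\emptyset\rangle\}$. Signature: for disjoint $X,Y\subseteq[m]$, $(X,Y)\ne(\emptyset,\emptyset)$, let $d_1\dots d_m$ be the string with $d_i=x$ if $i\in X$, $d_i=y$ if $i\in Y$, $d_i=z$ otherwise. Let $d'_1\dots d'_m$ be the unique string (indices cyclic modulo $m$) such that $d'_i=d_i$ if $d_i\in\{x,y\}$; and if $d_i=z$ then $d'_i\in\{\alpha,\beta\}$, $d'_i\ne d'_{i-1}$, with $d'_i=\beta$ if $d_{i-1}=x$ and $d'_i=\alpha$ if $d_{i-1}=y$. Then $\mathrm{sgn}(X,Y)$ is the set of those $e\in\{\alpha,\beta\}$ that occur an odd number of times in $d'_1\dots d'_m$; the singletons $\{\alpha\},\{\beta\}$ are written $\alpha,\beta$. It is invariant under replacing $(X,Y)$ by $(X+q,Y+q)$, and $\mathrm{sgn}\langle X|Y\rangle:=\mathrm{sgn}(X,Y)$ is well defined. For odd $m\ge3$ let $C_m=\{1,3,\dots,m-2\}$, $A_m=\{m\}\cup(C_m+1)\cup(C_m+1)'$, $B_m=\{m\}\cup C_m\cup C_m'$,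 and $$\mathcal H^m=\langle\{A_m,B_m\}\rangle\cup\bigcup\{Q\in\Omega\setminus\{\langle C_m|C_m+1\rangle,\langle C_m+1|C_m\rangle\}:\mathrm{sgn}\,Q=\beta\}.$$ For $i\in\{1,2\}$ let $\mathcal S^m_i=\mathcal H^m\cup\mathcal F^m_i$, a Sperner system over $E_m$. *)

theory Defs
  imports "HOL-Library.FuncSet"
begin

section \<open>Sperner systems and their Boolean functions\<close>

definition sperner_system :: "'a set \<Rightarrow> 'a set set \<Rightarrow> bool" where
  "sperner_system A \<A> \<longleftrightarrow>
     finite A \<and> (\<forall>S\<in>\<A>. S \<subseteq> A) \<and> (\<forall>S\<in>\<A>. \<forall>T\<in>\<A>. S \<subseteq> T \<longrightarrow> S = T)"

text \<open>
  \<open>{0,1}\<close> is rendered as \<^typ>\<open>bool\<close>, and an \<open>n\<close>-tuple over it as an extensional function on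
  \<open>{1..n}\<close>. The bijection \<open>b\<close> from the base set onto \<open>{1..n}\<close> is an explicit parameter.
\<close>

definition tuples :: "nat \<Rightarrow> (nat \<Rightarrow> bool) set" where
  "tuples n = {1..n} \<rightarrow>\<^sub>E UNIV"

definition complement_tuple :: "nat \<Rightarrow> (nat \<Rightarrow> bool) \<Rightarrow> (nat \<Rightarrow> bool)" where
  "complement_tuple n a = (\<lambda>i\<in>{1..n}. \<not> a i)"

definition self_dual :: "nat \<Rightarrow> ((nat \<Rightarrow> bool) \<Rightarrow> bool) \<Rightarrow> bool" where
  "self_dual n f \<longleftrightarrow> (\<forall>a\<in>tuples n. f a = (\<not> f (complement_tuple n a)))"

definition boolean_function :: "('a \<Rightarrow> nat) \<Rightarrow> 'a set set \<Rightarrow> (nat \<Rightarrow> bool) \<Rightarrow> bool" where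
  "boolean_function b \<A> a \<longleftrightarrow> (\<exists>S\<in>\<A>. \<forall>s\<in>S. a (b s))"


section \<open>The base set and its rotation\<close>

text \<open>Addition modulo \<open>m\<close> with representatives \<open>1, \<dots>, m\<close>; meaningful for \<open>x + q \<ge> 1\<close>.\<close>

definition cadd :: "nat \<Rightarrow> nat \<Rightarrow> nat \<Rightarrow> nat" where
  "cadd m x q = (x + q - 1) mod m + 1"

definition shift :: "nat \<Rightarrow> nat set \<Rightarrow> nat \<Rightarrow> nat set" where
  "shift m X q = (\<lambda>x. cadd m x q) ` X"

text \<open>
  \<^term>\<open>Inl n\<close> stands for \<open>n\<close> and \<^term>\<open>Inr n\<close> for its primed copy, so that \<^term>\<open>S <+> T\<close>
  is the union of \<open>S\<close> and the primed copy of \<open>T\<close>.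
\<close>

definition base_set :: "nat \<Rightarrow> (nat + nat) set" where
  "base_set m = {1..m} <+> {1..m}"

definition rho :: "nat \<Rightarrow> nat + nat \<Rightarrow> nat + nat" where
  "rho m = map_sum (\<lambda>j. cadd m j 1) (\<lambda>j. cadd m j 1)"

definition rot_closure :: "nat \<Rightarrow> (nat + nat) set set \<Rightarrow> (nat + nat) set set" where
  "rot_closure m \<A> = (\<Union>i\<in>{1..m}. (\<lambda>S. (rho m ^^ i) ` S) ` \<A>)"


section \<open>The set systems\<close>

definition F_block :: "nat \<Rightarrow> nat set \<Rightarrow> (nat + nat) set" where
  "F_block m J = J <+> ({1..m} - J)"

definition F1 :: "nat \<Rightarrow> (nat + nat) set set" where
  "F1 m = {F_block m J | J. J \<subseteq> {1..m} \<and> odd (card J)}"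

definition F2 :: "nat \<Rightarrow> (nat + nat) set set" where
  "F2 m = {F_block m J | J. J \<subseteq> {1..m} \<and> even (card J)}"

definition box :: "nat \<Rightarrow> nat set \<Rightarrow> nat set \<Rightarrow> (nat + nat) set set" where
  "box m X Y = {J. J \<subseteq> base_set m \<and>
     (\<forall>x\<in>X. card ({Inl x, Inr x} \<inter> J) = 2) \<and>
     (\<forall>y\<in>Y. card ({Inl y, Inr y} \<inter> J) = 0) \<and>
     (\<forall>z\<in>{1..m} - (X \<union> Y). card ({Inl z, Inr z} \<inter> J) = 1)}"

definition box_orbit :: "nat \<Rightarrow> nat set \<Rightarrow> nat set \<Rightarrow> (nat + nat) set set" where
  "box_orbit m X Y = rot_closure m (box m X Y)"

definition Omega :: "nat \<Rightarrow> (nat + nat) set set set" where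
  "Omega m = {box_orbit m X Y | X Y.
     X \<subseteq> {1..m} \<and> Y \<subseteq> {1..m} \<and> card X = card Y \<and> X \<inter> Y = {}} - {box_orbit m {} {}}"

datatype letter = Lx | Ly | Lz | Alpha | Beta

definition d_string :: "nat set \<Rightarrow> nat set \<Rightarrow> nat \<Rightarrow> letter" where
  "d_string X Y i = (if i \<in> X then Lx else if i \<in> Y then Ly else Lz)"

text \<open>The cyclic predecessor of an index \<open>i\<close> is \<^term>\<open>cadd m i (m - 1)\<close>.\<close>

definition is_completion :: "nat \<Rightarrow> nat set \<Rightarrow> nat set \<Rightarrow> (nat \<Rightarrow> letter) \<Rightarrow> bool" where
  "is_completion m X Y d' \<longleftrightarrow>
     d' \<in> {1..m} \<rightarrow>\<^sub>E UNIV \<and>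
     (\<forall>i\<in>{1..m}. let d = d_string X Y; p = cadd m i (m - 1) in
        (d i \<in> {Lx, Ly} \<longrightarrow> d' i = d i) \<and>
        (d i = Lz \<longrightarrow> d' i \<in> {Alpha, Beta} \<and> d' i \<noteq> d' p \<and>
           (d p = Lx \<longrightarrow> d' i = Beta) \<and> (d p = Ly \<longrightarrow> d' i = Alpha)))"

definition completion :: "nat \<Rightarrow> nat set \<Rightarrow> nat set \<Rightarrow> nat \<Rightarrow> letter" where
  "completion m X Y = (THE d'. is_completion m X Y d')"

definition sgn_pair :: "nat \<Rightarrow> nat set \<Rightarrow> nat set \<Rightarrow> letter set" where
  "sgn_pair m X Y = {e \<in> {Alpha, Beta}. odd (card {i\<in>{1..m}. completion m X Y i = e})}"

text \<open>
  The signature of an orbit is that of any pair generating it; independence of the pair is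
  \<open>sgn_orbit_box_orbit\<close> below.
\<close>

definition sgn_orbit :: "nat \<Rightarrow> (nat + nat) set set \<Rightarrow> letter set" where
  "sgn_orbit m Q = (THE s. \<exists>X Y. X \<subseteq> {1..m} \<and> Y \<subseteq> {1..m} \<and> X \<inter> Y = {} \<and>
     (X, Y) \<noteq> ({}, {}) \<and> Q = box_orbit m X Y \<and> s = sgn_pair m X Y)"

definition C_set :: "nat \<Rightarrow> nat set" where
  "C_set m = {k\<in>{1..m - 2}. odd k}"

definition A_block :: "nat \<Rightarrow> (nat + nat) set" where
  "A_block m = {Inl m} \<union> (shift m (C_set m) 1 <+> shift m (C_set m) 1)"

definition B_block :: "nat \<Rightarrow> (nat + nat) set" where
  "B_block m = {Inl m} \<union> (C_set m <+> C_set m)"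

definition H_system :: "nat \<Rightarrow> (nat + nat) set set" where
  "H_system m = rot_closure m {A_block m, B_block m} \<union>
     \<Union> {Q \<in> Omega m - {box_orbit m (C_set m) (shift m (C_set m) 1),
                        box_orbit m (shift m (C_set m) 1) (C_set m)}.
          sgn_orbit m Q = {Beta}}"

definition S_system :: "nat \<Rightarrow> nat \<Rightarrow> (nat + nat) set set" where
  "S_system m i = H_system m \<union> (if i = 1 then F1 m else F2 m)"


section \<open>Well-definedness of the signature\<close>

lemma cadd_in: "m \<ge> 1 \<Longrightarrow> cadd m x q \<in> {1..m}"
  by (auto simp: cadd_def Suc_le_eq)

lemma cadd_cadd: "x \<ge> 1 \<Longrightarrow> cadd m (cadd m x q) r = cadd m x (q + r)"
proof -
  assume "x \<ge> 1"
  then obtain y where "x = Suc y" by (cases x) auto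
  then show ?thesis by (simp add: cadd_def mod_add_left_eq add.assoc)
qed

lemma cadd_mult: "x \<in> {1..m} \<Longrightarrow> cadd m x (m * k) = x"
proof -
  assume x: "x \<in> {1..m}"
  then obtain y where "x = Suc y" by (cases x) auto
  with x show ?thesis by (simp add: cadd_def)
qed

lemma cadd_self: "x \<in> {1..m} \<Longrightarrow> cadd m x m = x"
  using cadd_mult[of x m 1] by simp

lemma cadd_inverse: "x \<in> {1..m} \<Longrightarrow> cadd m (cadd m x q) (m * q - q) = x"
proof -
  assume x: "x \<in> {1..m}"
  then have "q \<le> m * q" by auto
  with x show ?thesis using cadd_mult[of x m q] by (simp add: cadd_cadd)
qed

lemma cadd_bij: "bij_betw (\<lambda>x. cadd m x q) {1..m} {1..m}"
proof -
  have inj: "inj_on (\<lambda>x. cadd m x q) {1..m}"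
    by (rule inj_on_inverseI[where g = "\<lambda>x. cadd m x (m * q - q)"]) (rule cadd_inverse)
  have "(\<lambda>x. cadd m x q) ` {1..m} \<subseteq> {1..m}"
  proof (intro image_subsetI)
    fix x assume "x \<in> {1..m}"
    then show "cadd m x q \<in> {1..m}" by (intro cadd_in) auto
  qed
  then show ?thesis
    using inj by (simp add: bij_betw_def endo_inj_surj)
qed

lemma cadd_inj: "\<lbrakk>cadd m x q = cadd m y q; x \<in> {1..m}; y \<in> {1..m}\<rbrakk> \<Longrightarrow> x = y"
  by (rule inj_onD[OF bij_betw_imp_inj_on[OF cadd_bij]])

lemma cadd_mem_shift:
  assumes "X \<subseteq> {1..m}" "i \<in> {1..m}"
  shows "cadd m i q \<in> shift m X q \<longleftrightarrow> i \<in> X"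
  unfolding shift_def
  by (rule inj_on_image_mem_iff[OF bij_betw_imp_inj_on[OF cadd_bij] assms(2,1)])

lemma shift_subset: "X \<subseteq> {1..m} \<Longrightarrow> shift m X q \<subseteq> {1..m}"
  unfolding shift_def using image_mono[of X "{1..m}" "\<lambda>x. cadd m x q"]
  by (simp only: bij_betw_imp_surj_on[OF cadd_bij])

lemma cadd_reach:
  assumes "p \<in> {1..m}" "i \<in> {1..m}"
  obtains k where "k < m" "i = cadd m p k"
proof -
  obtain i' p' where [simp]: "i = Suc i'" "p = Suc p'" using assms by (cases i; cases p) auto
  have "cadd m p ((i + m - p) mod m) = i"
    using assms by (simp add: cadd_def mod_add_right_eq)
  then show thesis using that[of "(i + m - p) mod m"] assms by auto
qed

primrec next_letter :: "letter \<Rightarrow> letter" where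
  "next_letter Lx = Beta"
| "next_letter Ly = Alpha"
| "next_letter Lz = Lz"
| "next_letter Alpha = Beta"
| "next_letter Beta = Alpha"

lemma d_string_cases: "d_string X Y i \<in> {Lx, Ly, Lz}"
  by (simp add: d_string_def)

lemma next_letter_eq:
  assumes "u \<in> {Lx, Ly, Lz}" "v \<in> {Lx, Ly, Lz}"
    and "u \<in> {Lx, Ly} \<longrightarrow> a = u"
    and "u = Lz \<longrightarrow> a \<in> {Alpha, Beta} \<and> a \<noteq> b \<and> (v = Lx \<longrightarrow> a = Beta) \<and> (v = Ly \<longrightarrow> a = Alpha)"
    and "v \<in> {Lx, Ly} \<longrightarrow> b = v" "v = Lz \<longrightarrow> b \<in> {Alpha, Beta}"
  shows "a = (if u = Lz then next_letter b else u)"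
  using assms by (cases u; cases v) auto

lemma completion_step:
  assumes "is_completion m X Y e" "m \<ge> 1" "i \<in> {1..m}"
  shows "e i = (if d_string X Y i = Lz then next_letter (e (cadd m i (m - 1))) else d_string X Y i)"
proof -
  have p: "cadd m i (m - 1) \<in> {1..m}" using assms(2) by (rule cadd_in)
  note * = assms(1)[unfolded is_completion_def Let_def, THEN conjunct2, THEN bspec]
  have pz: "d_string X Y (cadd m i (m - 1)) = Lz \<longrightarrow> e (cadd m i (m - 1)) \<in> {Alpha, Beta}"
    using *[OF p] by blast
  show ?thesis
    by (rule next_letter_eq[OF d_string_cases d_string_cases *[OF assms(3), THEN conjunct1]
          *[OF assms(3), THEN conjunct2] *[OF p, THEN conjunct1] pz])
qed

primrec walk :: "nat \<Rightarrow> nat set \<Rightarrow> nat set \<Rightarrow> nat \<Rightarrow> nat \<Rightarrow> letter" where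
  "walk m X Y p 0 = d_string X Y p"
| "walk m X Y p (Suc k) =
     (if d_string X Y (cadd m p (Suc k)) = Lz then next_letter (walk m X Y p k)
      else d_string X Y (cadd m p (Suc k)))"

lemma cadd_pred: "p \<in> {1..m} \<Longrightarrow> cadd m (cadd m p (Suc k)) (m - 1) = cadd m p k"
proof -
  assume p: "p \<in> {1..m}"
  then have "cadd m (cadd m p (Suc k)) (m - 1) = cadd m p (m + k)"
    by (simp add: cadd_cadd add.commute)
  also have "\<dots> = cadd m (cadd m p m) k" using p by (subst cadd_cadd) auto
  finally show ?thesis using p by (simp add: cadd_self)
qed

lemma cadd_0: "p \<in> {1..m} \<Longrightarrow> cadd m p 0 = p"
  using cadd_mult[of p m 0] by simp

lemma completion_eq_walk:
  assumes "is_completion m X Y e" "p \<in> X \<union> Y" "p \<in> {1..m}"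
  shows "e (cadd m p k) = walk m X Y p k"
proof (induction k)
  have m: "m \<ge> 1" using assms(3) by auto
  {
    case 0
    show ?case using completion_step[OF assms(1) m assms(3)] assms(2)
      by (auto simp: cadd_0[OF assms(3)] d_string_def)
  next
    case (Suc k)
    show ?case
      using completion_step[OF assms(1) m cadd_in[OF m], of p "Suc k"] Suc
      by (simp add: cadd_pred[OF assms(3)] del: One_nat_def)
  }
qed

lemma is_completionI:
  assumes "e \<in> {1..m} \<rightarrow>\<^sub>E UNIV" "m \<ge> 1"
    and step: "\<And>i. i \<in> {1..m} \<Longrightarrow> e i \<noteq> Lz \<and>
      e i = (if d_string X Y i = Lz then next_letter (e (cadd m i (m - 1))) else d_string X Y i)"
  shows "is_completion m X Y e"
  unfolding is_completion_def Let_def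
proof (intro conjI ballI impI)
  fix i assume i: "i \<in> {1..m}"
  let ?p = "cadd m i (m - 1)"
  have p: "?p \<in> {1..m}" using cadd_in assms(2) by blast
  show "d_string X Y i \<in> {Lx, Ly} \<Longrightarrow> e i = d_string X Y i" using step[OF i] by auto
  assume z: "d_string X Y i = Lz"
  show "e i \<in> {Alpha, Beta}" "e i \<noteq> e ?p"
    using step[OF i] step[OF p] z by (cases "e ?p"; simp)+
  show "d_string X Y ?p = Lx \<Longrightarrow> e i = Beta" "d_string X Y ?p = Ly \<Longrightarrow> e i = Alpha"
    using step[OF i] step[OF p] z by (auto split: if_splits)
qed (rule assms(1))

lemma walk_not_Lz: "p \<in> X \<union> Y \<Longrightarrow> walk m X Y p k \<noteq> Lz"
proof (induction k)
  case (Suc k)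
  then show ?case by (cases "walk m X Y p k") auto
qed (auto simp: d_string_def)

theorem ex1_completion:
  assumes XY: "X \<subseteq> {1..m}" "Y \<subseteq> {1..m}" "(X, Y) \<noteq> ({}, {})"
  shows "\<exists>!e. is_completion m X Y e"
proof -
  obtain p where p: "p \<in> X \<union> Y" "p \<in> {1..m}" using XY by blast
  then have m: "m \<ge> 1" by auto
  define off where "off i = (THE k. k < m \<and> i = cadd m p k)" for i
  have off: "off (cadd m p k) = k" if "k < m" for k
    unfolding off_def
  proof (rule the_equality)
    fix l assume l: "l < m \<and> cadd m p k = cadd m p l"
    have "cadd m (Suc k) (p - 1) = cadd m (Suc l) (p - 1)"
      using l p by (simp add: cadd_def add.commute)
    then show "l = k" using cadd_inj[of m "Suc k" "p - 1" "Suc l"] l that by auto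
  qed (use that in simp)
  define e where "e = (\<lambda>i\<in>{1..m}. walk m X Y p (off i))"
  have e: "e (cadd m p k) = walk m X Y p k" if "k < m" for k
    using cadd_in[OF m] off[OF that] by (simp add: e_def del: atLeastAtMost_iff)
  have "is_completion m X Y e"
  proof (rule is_completionI)
    fix i assume i: "i \<in> {1..m}"
    obtain k where k: "k < m" "i = cadd m p k" using cadd_reach[OF p(2) i] .
    show "e i \<noteq> Lz \<and>
      e i = (if d_string X Y i = Lz then next_letter (e (cadd m i (m - 1))) else d_string X Y i)"
    proof (cases k)
      case 0
      then have "i = p" using k p by (simp add: cadd_0)
      with 0 show ?thesis using k p e[of 0] by (auto simp: d_string_def)
    next
      case (Suc l)
      then have "cadd m i (m - 1) = cadd m p l" using cadd_pred[OF p(2)] k by simp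
      then show ?thesis
        using e[of l] e[OF k(1)] walk_not_Lz[OF p(1), of m k] k Suc by simp
    qed
  qed (use m in \<open>auto simp: e_def\<close>)
  moreover have "f = g" if "is_completion m X Y f" "is_completion m X Y g" for f g
  proof (rule PiE_ext)
    show "f \<in> {1..m} \<rightarrow>\<^sub>E UNIV" "g \<in> {1..m} \<rightarrow>\<^sub>E UNIV"
      using that by (auto simp: is_completion_def)
    fix i assume "i \<in> {1..m}"
    then obtain k where "i = cadd m p k" using cadd_reach[OF p(2)] by metis
    then show "f i = g i" using completion_eq_walk[OF _ p] that by metis
  qed
  ultimately show ?thesis by blast
qed

lemma is_completion_completion:
  assumes "X \<subseteq> {1..m}" "Y \<subseteq> {1..m}" "(X, Y) \<noteq> ({}, {})"
  shows "is_completion m X Y (completion m X Y)"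
  unfolding completion_def by (rule theI'[OF ex1_completion[OF assms]])

lemma sgn_pair_shift:
  assumes XY: "X \<subseteq> {1..m}" "Y \<subseteq> {1..m}" "(X, Y) \<noteq> ({}, {})"
  shows "sgn_pair m (shift m X q) (shift m Y q) = sgn_pair m X Y"
proof -
  have m: "m \<ge> 1" using XY by (cases m) auto
  let ?X = "shift m X q" and ?Y = "shift m Y q"
  define f where "f = completion m ?X ?Y"
  have "(?X, ?Y) \<noteq> ({}, {})" using XY(3) by (auto simp: shift_def)
  then have f: "is_completion m ?X ?Y f"
    unfolding f_def using XY by (intro is_completion_completion shift_subset)
  have d: "d_string ?X ?Y (cadd m i q) = d_string X Y i" if "i \<in> {1..m}" for i
    using that XY by (simp add: d_string_def cadd_mem_shift del: atLeastAtMost_iff)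
  have pred: "cadd m (cadd m i q) (m - 1) = cadd m (cadd m i (m - 1)) q"
    if "i \<in> {1..m}" for i
    using that by (simp add: cadd_cadd add.commute)
  have "is_completion m X Y (\<lambda>i\<in>{1..m}. f (cadd m i q))"
    unfolding is_completion_def Let_def
  proof (intro conjI ballI)
    fix i assume i: "i \<in> {1..m}"
    then have ip: "cadd m i q \<in> {1..m}" "cadd m i (m - 1) \<in> {1..m}" using cadd_in[OF m] by auto
    note * = f[unfolded is_completion_def Let_def, THEN conjunct2, THEN bspec, OF ip(1)]
    show "d_string X Y i \<in> {Lx, Ly} \<longrightarrow> (\<lambda>i\<in>{1..m}. f (cadd m i q)) i = d_string X Y i"
      using * i by (simp add: d del: atLeastAtMost_iff)
    show "d_string X Y i = Lz \<longrightarrow>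
        (\<lambda>i\<in>{1..m}. f (cadd m i q)) i \<in> {Alpha, Beta} \<and>
        (\<lambda>i\<in>{1..m}. f (cadd m i q)) i \<noteq> (\<lambda>i\<in>{1..m}. f (cadd m i q)) (cadd m i (m - 1)) \<and>
        (d_string X Y (cadd m i (m - 1)) = Lx \<longrightarrow> (\<lambda>i\<in>{1..m}. f (cadd m i q)) i = Beta) \<and>
        (d_string X Y (cadd m i (m - 1)) = Ly \<longrightarrow> (\<lambda>i\<in>{1..m}. f (cadd m i q)) i = Alpha)"
      using * i ip(2) d[OF i] d[OF ip(2)] pred[OF i] by (simp del: atLeastAtMost_iff)
  qed auto
  then have c: "completion m X Y = (\<lambda>i\<in>{1..m}. f (cadd m i q))"
    using ex1_completion[OF XY] is_completion_completion[OF XY] by blast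
  have "card {i\<in>{1..m}. completion m X Y i = e} = card {j\<in>{1..m}. f j = e}" for e
  proof (rule bij_betw_same_card[of "\<lambda>i. cadd m i q"])
    have "{j\<in>{1..m}. f j = e} = (\<lambda>i. cadd m i q) ` {i\<in>{1..m}. completion m X Y i = e}"
    proof (intro equalityI subsetI)
      fix j assume j: "j \<in> {j\<in>{1..m}. f j = e}"
      then obtain i where "i \<in> {1..m}" "j = cadd m i q"
        using cadd_bij[of m q] unfolding bij_betw_def by blast
      with j show "j \<in> (\<lambda>i. cadd m i q) ` {i\<in>{1..m}. completion m X Y i = e}" by (auto simp: c)
    qed (use cadd_in[OF m] in \<open>auto simp: c\<close>)
    then show "bij_betw (\<lambda>i. cadd m i q) {i\<in>{1..m}. completion m X Y i = e} {j\<in>{1..m}. f j = e}"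
      using inj_on_subset[OF bij_betw_imp_inj_on[OF cadd_bij[of m q]]]
      unfolding bij_betw_def by (metis (no_types, lifting) mem_Collect_eq subsetI)
  qed
  then show ?thesis by (simp add: sgn_pair_def f_def)
qed

lemma rho_funpow:
  assumes "J \<subseteq> base_set m"
  shows "(rho m ^^ q) ` J = map_sum (\<lambda>x. cadd m x q) (\<lambda>x. cadd m x q) ` J"
proof (rule image_cong[OF refl])
  fix s assume "s \<in> J"
  then have s: "s \<in> base_set m" using assms by blast
  show "(rho m ^^ q) s = map_sum (\<lambda>x. cadd m x q) (\<lambda>x. cadd m x q) s"
  proof (induction q)
    case 0
    show ?case using s cadd_0[of _ m] by (auto simp: base_set_def)
  next
    case (Suc q)
    then show ?case using s by (auto simp: rho_def base_set_def cadd_cadd)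
  qed
qed

lemma mem_box:
  "J \<in> box m X Y \<longleftrightarrow> J \<subseteq> base_set m \<and>
     (\<forall>x\<in>X. Inl x \<in> J \<and> Inr x \<in> J) \<and> (\<forall>y\<in>Y. Inl y \<notin> J \<and> Inr y \<notin> J) \<and>
     (\<forall>z\<in>{1..m} - (X \<union> Y). (Inl z \<in> J) \<noteq> (Inr z \<in> J))"
proof -
  have c: "card ({Inl x, Inr x} \<inter> J) = of_bool (Inl x \<in> J) + of_bool (Inr x \<in> J)" for x
    by (cases "Inl x \<in> J"; cases "Inr x \<in> J") (auto simp: Int_insert_left)
  have *: "card ({Inl x, Inr x} \<inter> J) = 2 \<longleftrightarrow> Inl x \<in> J \<and> Inr x \<in> J"
    "card ({Inl x, Inr x} \<inter> J) = 0 \<longleftrightarrow> Inl x \<notin> J \<and> Inr x \<notin> J"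
    "card ({Inl x, Inr x} \<inter> J) = 1 \<longleftrightarrow> (Inl x \<in> J) \<noteq> (Inr x \<in> J)" for x
    unfolding c by (cases "Inl x \<in> J"; cases "Inr x \<in> J"; simp)+
  show ?thesis by (simp only: box_def mem_Collect_eq *)
qed

lemma box_determines:
  assumes "J \<in> box m X Y" "X \<subseteq> {1..m}" "Y \<subseteq> {1..m}"
  shows "X = {x\<in>{1..m}. Inl x \<in> J \<and> Inr x \<in> J}" "Y = {y\<in>{1..m}. Inl y \<notin> J \<and> Inr y \<notin> J}"
  using assms by (auto simp: mem_box subset_iff)

lemma rho_box:
  assumes J: "J \<in> box m X Y" and XY: "X \<subseteq> {1..m}" "Y \<subseteq> {1..m}"
  shows "(rho m ^^ q) ` J \<in> box m (shift m X q) (shift m Y q)"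
proof -
  let ?s = "\<lambda>x. cadd m x q" and ?K = "(rho m ^^ q) ` J"
  have JE: "J \<subseteq> base_set m" using J by (simp add: mem_box)
  have K: "?K = map_sum ?s ?s ` J" by (rule rho_funpow[OF JE])
  have sub: "?K \<subseteq> base_set m"
  proof
    fix t assume "t \<in> ?K"
    then obtain u where u: "u \<in> J" "t = map_sum ?s ?s u" unfolding K by blast
    have "?s x \<in> {1..m}" if "x \<in> {1..m}" for x
      using bij_betwE[OF cadd_bij[of m q]] that by blast
    with u JE show "t \<in> base_set m" by (force simp: base_set_def)
  qed
  have l: "Inl (?s x) \<in> ?K \<longleftrightarrow> Inl x \<in> J" if "x \<in> {1..m}" for x
  proof
    assume "Inl (?s x) \<in> ?K"
    then obtain u where u: "u \<in> J" "Inl (?s x) = map_sum ?s ?s u" unfolding K by blast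
    then obtain y where y: "u = Inl y" "?s x = ?s y" by (cases u) auto
    with u JE have "y \<in> {1..m}" by (auto simp: base_set_def)
    with y that u show "Inl x \<in> J" using cadd_inj[of m x q y] by simp
  qed (force simp: K)
  have r: "Inr (?s x) \<in> ?K \<longleftrightarrow> Inr x \<in> J" if "x \<in> {1..m}" for x
  proof
    assume "Inr (?s x) \<in> ?K"
    then obtain u where u: "u \<in> J" "Inr (?s x) = map_sum ?s ?s u" unfolding K by blast
    then obtain y where y: "u = Inr y" "?s x = ?s y" by (cases u) auto
    with u JE have "y \<in> {1..m}" by (auto simp: base_set_def)
    with y that u show "Inr x \<in> J" using cadd_inj[of m x q y] by simp
  qed (force simp: K)
  have z: "(Inl z \<in> ?K) \<noteq> (Inr z \<in> ?K)" if zz: "z \<in> {1..m} - (shift m X q \<union> shift m Y q)" for z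
  proof -
    obtain w where w: "w \<in> {1..m}" "z = ?s w"
      using cadd_bij[of m q] zz unfolding bij_betw_def by blast
    then have "w \<notin> X \<union> Y" using zz by (auto simp: shift_def)
    with w l r J show ?thesis by (auto simp: mem_box)
  qed
  have "\<forall>x\<in>X. Inl (?s x) \<in> ?K \<and> Inr (?s x) \<in> ?K"
    using J XY l r by (auto simp: mem_box subset_iff)
  then have XK: "\<forall>x\<in>shift m X q. Inl x \<in> ?K \<and> Inr x \<in> ?K"
    unfolding shift_def by simp
  have "\<forall>y\<in>Y. Inl (?s y) \<notin> ?K \<and> Inr (?s y) \<notin> ?K"
    using J XY l r by (auto simp: mem_box subset_iff)
  then have YK: "\<forall>y\<in>shift m Y q. Inl y \<notin> ?K \<and> Inr y \<notin> ?K"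
    unfolding shift_def by simp
  show ?thesis using sub XK YK z unfolding mem_box by blast
qed

lemma box_subset_orbit: "m \<ge> 1 \<Longrightarrow> box m X Y \<subseteq> box_orbit m X Y"
proof
  fix J assume m: "m \<ge> 1" and J: "J \<in> box m X Y"
  from J have JE: "J \<subseteq> base_set m" unfolding mem_box by blast
  have "map_sum (\<lambda>x. cadd m x m) (\<lambda>x. cadd m x m) s = s" if "s \<in> J" for s
  proof -
    have "s \<in> base_set m" using that JE by blast
    then show ?thesis unfolding base_set_def using cadd_self[of _ m] by (cases s) auto
  qed
  then have "J = (rho m ^^ m) ` J"
    unfolding rho_funpow[OF JE] by simp
  moreover have "m \<in> {1..m}" using m by simp
  ultimately show "J \<in> box_orbit m X Y"
    using J unfolding box_orbit_def rot_closure_def by blast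
qed

lemma box_orbit_eqD:
  assumes XY: "X \<subseteq> {1..m}" "Y \<subseteq> {1..m}" "X \<inter> Y = {}" and m: "m \<ge> 1"
    and UV: "U \<subseteq> {1..m}" "V \<subseteq> {1..m}"
    and eq: "box_orbit m X Y = box_orbit m U V"
  obtains q where "X = shift m U q" "Y = shift m V q"
proof -
  let ?J = "X <+> ({1..m} - Y)"
  have J: "?J \<in> box m X Y"
    using XY by (auto simp: mem_box base_set_def)
  then have "?J \<in> box_orbit m U V"
    using box_subset_orbit[OF m] eq by blast
  then obtain q K where "K \<in> box m U V" "?J = (rho m ^^ q) ` K"
    unfolding box_orbit_def rot_closure_def by blast
  then have K: "?J \<in> box m (shift m U q) (shift m V q)"
    using rho_box[OF _ UV] by simp
  have "X = shift m U q" "Y = shift m V q"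
    using box_determines[OF J XY(1,2)] box_determines[OF K shift_subset shift_subset, OF UV]
    by (simp_all only:)
  then show thesis by (rule that)
qed

theorem sgn_orbit_box_orbit:
  assumes XY: "X \<subseteq> {1..m}" "Y \<subseteq> {1..m}" "X \<inter> Y = {}" "(X, Y) \<noteq> ({}, {})"
  shows "sgn_orbit m (box_orbit m X Y) = sgn_pair m X Y"
  unfolding sgn_orbit_def
proof (rule the_equality)
  fix s assume "\<exists>U V. U \<subseteq> {1..m} \<and> V \<subseteq> {1..m} \<and> U \<inter> V = {} \<and> (U, V) \<noteq> ({}, {}) \<and>
    box_orbit m X Y = box_orbit m U V \<and> s = sgn_pair m U V"
  then obtain U V where UV: "U \<subseteq> {1..m}" "V \<subseteq> {1..m}" "(U, V) \<noteq> ({}, {})"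
    and eq: "box_orbit m X Y = box_orbit m U V" and s: "s = sgn_pair m U V" by blast
  have m: "m \<ge> 1" using XY by (cases m) auto
  obtain q where "X = shift m U q" "Y = shift m V q"
    using box_orbit_eqD[OF XY(1-3) m UV(1,2) eq] .
  then show "s = sgn_pair m X Y" using sgn_pair_shift[OF UV] s by simp
qed (use XY in blast)


section \<open>The systems are Sperner\<close>

lemma card_box:
  assumes J: "J \<in> box m X Y" and XY: "X \<subseteq> {1..m}" "Y \<subseteq> {1..m}" "X \<inter> Y = {}" "card X = card Y"
  shows "card J = m"
proof -
  let ?Z = "{1..m} - (X \<union> Y)"
  have fin: "finite X" "finite Y" using finite_subset[OF XY(1)] finite_subset[OF XY(2)] by auto
  have Jeq: "J = (\<Union>k\<in>{1..m}. {Inl k, Inr k} \<inter> J)"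
    using J by (auto simp: mem_box base_set_def)
  have "card J = (\<Sum>k\<in>{1..m}. card ({Inl k, Inr k} \<inter> J))"
    by (subst Jeq, rule card_UN_disjoint) auto
  also have "{1..m} = X \<union> (Y \<union> ?Z)" using XY by auto
  also have "(\<Sum>k\<in>X \<union> (Y \<union> ?Z). card ({Inl k, Inr k} \<inter> J)) = 2 * card X + card ?Z"
    using XY(3) fin J by (subst sum.union_disjoint; (subst sum.union_disjoint)?) (auto simp: box_def)
  also have "card ?Z = m - 2 * card X"
    using XY fin by (subst card_Diff_subset) (auto simp: card_Un_disjoint)
  also have "2 * card X \<le> m"
    using card_mono[of "{1..m}" "X \<union> Y"] XY fin by (simp add: card_Un_disjoint)
  ultimately show ?thesis by linarith
qed

lemma rho_image:
  assumes "J \<subseteq> base_set m"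
  shows "(rho m ^^ q) ` J \<subseteq> base_set m" "card ((rho m ^^ q) ` J) = card J"
proof -
  let ?s = "\<lambda>x. cadd m x q"
  have "map_sum ?s ?s u \<in> base_set m" if "u \<in> base_set m" for u
  proof -
    have "m \<ge> 1" using that by (auto simp: base_set_def)
    then have "?s x \<in> {1..m}" for x by (rule cadd_in)
    then show ?thesis by (cases u) (simp_all add: base_set_def InlI InrI del: atLeastAtMost_iff)
  qed
  then show "(rho m ^^ q) ` J \<subseteq> base_set m"
    unfolding rho_funpow[OF assms] using assms by blast
  have "inj_on (map_sum ?s ?s) (base_set m)"
  proof (rule inj_onI)
    fix u v assume "u \<in> base_set m" "v \<in> base_set m" "map_sum ?s ?s u = map_sum ?s ?s v"
    then show "u = v"
      unfolding base_set_def
      by (elim PlusE) (auto dest: cadd_inj simp del: atLeastAtMost_iff One_nat_def)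
  qed
  then show "card ((rho m ^^ q) ` J) = card J"
    unfolding rho_funpow[OF assms] by (rule card_image[OF inj_on_subset[OF _ assms]])
qed

lemma card_C_set: "odd m \<Longrightarrow> 2 * card (C_set m) + 1 = m"
proof -
  assume "odd m"
  then obtain k where k: "m = 2 * k + 1" by (elim oddE)
  have "C_set m = (\<lambda>j. 2 * j + 1) ` {..<k}"
    unfolding C_set_def k by (auto elim!: oddE)
  then have "card (C_set m) = k" by (simp add: card_image inj_on_def)
  then show ?thesis using k by simp
qed

lemma A_B_blocks:
  assumes "odd m" "S \<in> {A_block m, B_block m}"
  shows "S \<subseteq> base_set m \<and> card S = m"
proof -
  have "m \<ge> 1" using assms by (cases m) auto
  have C: "C_set m \<subseteq> {1..m}" by (auto simp: C_set_def)
  have sub: "shift m (C_set m) 1 \<subseteq> {1..m}" using C by (rule shift_subset)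
  have m1: "m \<notin> C_set m" by (auto simp: C_set_def)
  have m2: "m \<notin> shift m (C_set m) 1" by (auto simp: C_set_def shift_def cadd_def)
  have "card (shift m (C_set m) 1) = card (C_set m)"
    unfolding shift_def
    by (rule card_image) (rule inj_on_subset[OF bij_betw_imp_inj_on[OF cadd_bij] C])
  moreover have "card (insert (Inl m) (D <+> D)) = 2 * card D + 1"
    if "D \<subseteq> {1..m}" "m \<notin> D" for D :: "nat set"
  proof -
    have "finite D" using finite_subset[OF that(1)] by simp
    with that show ?thesis by (subst card_insert_disjoint) (auto simp: card_Plus)
  qed
  ultimately have "card S = m"
    using assms card_C_set[OF assms(1)] C sub m1 m2 by (auto simp: A_block_def B_block_def)
  moreover have "S \<subseteq> base_set m"
    using assms C sub \<open>m \<ge> 1\<close> by (auto simp: A_block_def B_block_def base_set_def)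
  ultimately show ?thesis by blast
qed

lemma S_system_block:
  assumes "odd m" "S \<in> S_system m i"
  shows "S \<subseteq> base_set m \<and> card S = m"
proof -
  have rot: "S \<subseteq> base_set m \<and> card S = m"
    if S: "S \<in> rot_closure m \<A>" and A: "\<And>T. T \<in> \<A> \<Longrightarrow> T \<subseteq> base_set m \<and> card T = m" for \<A>
  proof -
    obtain T q where "T \<in> \<A>" "S = (rho m ^^ q) ` T"
      using S unfolding rot_closure_def by blast
    then show ?thesis using A[of T] rho_image[of T m q] by simp
  qed
  consider "S \<in> F1 m \<union> F2 m" | "S \<in> rot_closure m {A_block m, B_block m}" | Q where "S \<in> Q" "Q \<in> Omega m"
    using assms(2) unfolding S_system_def H_system_def by (cases "i = 1") (simp_all, blast+)
  then show ?thesis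
  proof cases
    case 1
    then obtain J where J: "J \<subseteq> {1..m}" "S = J <+> ({1..m} - J)"
      by (auto simp: F1_def F2_def F_block_def)
    have "finite J" using finite_subset[OF J(1)] by simp
    with J(1) have "card S = m"
      using card_mono[of "{1..m}" J] by (simp add: J(2) card_Plus card_Diff_subset)
    moreover have "S \<subseteq> base_set m" using J(1) by (auto simp: J(2) base_set_def)
    ultimately show ?thesis by simp
  next
    case 2
    show ?thesis by (rule rot[OF 2]) (rule A_B_blocks[OF assms(1)])
  next
    case 3
    then obtain X Y where XY: "X \<subseteq> {1..m}" "Y \<subseteq> {1..m}" "X \<inter> Y = {}" "card X = card Y"
      and S: "S \<in> rot_closure m (box m X Y)"
      by (auto simp: Omega_def box_orbit_def)
    show ?thesis by (rule rot[OF S]) (use card_box[OF _ XY] in \<open>simp add: mem_box\<close>)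
  qed
qed

theorem S_system_sperner:
  assumes "odd m"
  shows "sperner_system (base_set m) (S_system m i)"
proof -
  have fin: "finite (base_set m)" by (simp add: base_set_def)
  have "S = T" if "S \<in> S_system m i" "T \<in> S_system m i" "S \<subseteq> T" for S T
    using S_system_block[OF assms that(1)] S_system_block[OF assms that(2)] that(3) fin
    by (metis card_subset_eq finite_subset)
  with fin show ?thesis
    using S_system_block[OF assms] unfolding sperner_system_def by blast
qed

end

theory Submission
  imports Defs
begin

text \<open>
  All blocks have size \<open>m\<close>, half the size of the base set. So self-duality means that among two
  complementary sets of size \<open>m\<close> exactly one is a block, and that every set of size \<open>m + 1\<close>
  contains a block. Complementing turns \<open>[X|Y]\<close> into \<open>[Y|X]\<close>, which exchanges the letters
  \<open>\<alpha>\<close> and \<open>\<beta>\<close>; as \<open>m\<close> is odd, exactly one of them occurs oddly often.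

  A set of size \<open>m + 1\<close> lies in some \<open>[X|Y]\<close> with \<open>|X| = |Y| + 1\<close>, and removing a point turns
  one letter \<open>x\<close> into \<open>z\<close> or one letter \<open>z\<close> into \<open>y\<close>. The moves used below change the completed
  string at that position only. If \<open>\<beta>\<close> occurs oddly often, look at some \<open>x\<close> not preceded by
  \<open>x\<close>: after \<open>y\<close> or \<open>\<beta>\<close> it may become \<open>\<alpha>\<close>, and if the preceding letter is \<open>\<alpha>\<close>, that
  one may become \<open>y\<close>. If \<open>\<beta>\<close> occurs evenly often, any \<open>\<beta>\<close> may become \<open>y\<close>; if there is none,
  then since \<open>|X| > |Y|\<close> some \<open>x\<close> is preceded by \<open>x\<close> and may become \<open>\<beta>\<close>. Whenever such a move
  ends in an exceptional orbit, either the set contains the required rotation of \<open>A\<^sub>m\<close> or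
  \<open>B\<^sub>m\<close>, or another move does not end in one.
\<close>

section \<open>Completed strings and their signature\<close>

definition csuc :: "nat \<Rightarrow> nat \<Rightarrow> nat" where
  "csuc m i = cadd m i 1"

lemma csuc_in: "i \<in> {1..m} \<Longrightarrow> csuc m i \<in> {1..m}"
  unfolding csuc_def by (rule cadd_in) auto

lemma csuc_inj: "\<lbrakk>csuc m i = csuc m j; i \<in> {1..m}; j \<in> {1..m}\<rbrakk> \<Longrightarrow> i = j"
  unfolding csuc_def by (rule cadd_inj)

lemma inj_on_csuc: "inj_on (csuc m) {1..m}"
  by (rule inj_onI) (rule csuc_inj)

lemma csuc_surj:
  assumes "i \<in> {1..m}"
  obtains j where "j \<in> {1..m}" "i = csuc m j"
  using assms cadd_bij[of m 1] unfolding bij_betw_def csuc_def by blast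

lemma csuc_neq: "\<lbrakk>m \<ge> 2; i \<in> {1..m}\<rbrakk> \<Longrightarrow> csuc m i \<noteq> i"
  by (cases "i = m") (auto simp: csuc_def cadd_def)

lemma pred_csuc: "i \<in> {1..m} \<Longrightarrow> cadd m (csuc m i) (m - 1) = i"
  using cadd_pred[of i m 0] by (simp add: csuc_def cadd_0)

lemma csuc_cadd: "x \<ge> 1 \<Longrightarrow> csuc m (cadd m x q) = cadd m (csuc m x) q"
  by (simp add: csuc_def cadd_cadd add.commute)

text \<open>The pair (X, Y) is read off from the string as the positions of x and y, so changing one
  letter changes string and pair together. The single rule \<open>next_letter\<close> covers both
  the alternation and the letter forced after x or y.\<close>

definition completed :: "nat \<Rightarrow> (nat \<Rightarrow> letter) \<Rightarrow> bool" where
  "completed m e \<longleftrightarrow> e \<in> {1..m} \<rightarrow>\<^sub>E UNIV \<and>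
     (\<forall>i\<in>{1..m}. e i \<noteq> Lz \<and>
        (e (csuc m i) \<in> {Alpha, Beta} \<longrightarrow> e (csuc m i) = next_letter (e i)))"

definition occ :: "nat \<Rightarrow> (nat \<Rightarrow> letter) \<Rightarrow> letter \<Rightarrow> nat set" where
  "occ m e l = {i\<in>{1..m}. e i = l}"

lemma finite_occ [simp]: "finite (occ m e l)"
  by (simp add: occ_def)

lemma completed_csuc:
  "\<lbrakk>completed m e; i \<in> {1..m}; e (csuc m i) \<in> {Alpha, Beta}\<rbrakk> \<Longrightarrow> e (csuc m i) = next_letter (e i)"
  unfolding completed_def by blast

lemma completed_not_Lz: "\<lbrakk>completed m e; i \<in> {1..m}\<rbrakk> \<Longrightarrow> e i \<noteq> Lz"
  unfolding completed_def by blast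

lemma is_completion_completed:
  assumes e: "completed m e" and m: "m \<ge> 1"
  shows "is_completion m (occ m e Lx) (occ m e Ly) e"
proof (rule is_completionI[OF _ m])
  show "e \<in> {1..m} \<rightarrow>\<^sub>E UNIV" using e by (simp add: completed_def)
  fix i assume i: "i \<in> {1..m}"
  obtain j where j: "j \<in> {1..m}" "i = csuc m j" using csuc_surj[OF i] .
  have "cadd m i (m - 1) = j" using pred_csuc[OF j(1)] j(2) by simp
  moreover have "d_string (occ m e Lx) (occ m e Ly) i = (if e i \<in> {Lx, Ly} then e i else Lz)"
    using i by (auto simp: d_string_def occ_def)
  ultimately show "e i \<noteq> Lz \<and> e i =
      (if d_string (occ m e Lx) (occ m e Ly) i = Lz then next_letter (e (cadd m i (m - 1)))
       else d_string (occ m e Lx) (occ m e Ly) i)"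
    using completed_csuc[OF e j(1)] completed_not_Lz[OF e i] j(2) by (cases "e i") auto
qed

text \<open>Converse to \<open>is_completion_completed\<close>: every pair can be traded for its
  completed string, on which the moves act.\<close>

lemma ex_completed:
  assumes XY: "X \<subseteq> {1..m}" "Y \<subseteq> {1..m}" "X \<inter> Y = {}" "(X, Y) \<noteq> ({}, {})"
  obtains e where "completed m e" "X = occ m e Lx" "Y = occ m e Ly"
proof -
  obtain e where e: "is_completion m X Y e" using ex1_completion[OF XY(1,2,4)] by blast
  have m: "m \<ge> 1" using XY by (cases m) auto
  have ext: "e \<in> {1..m} \<rightarrow>\<^sub>E UNIV" using e unfolding is_completion_def by blast
  have l: "(d_string X Y i \<in> {Lx, Ly} \<longrightarrow> e i = d_string X Y i) \<and>
      (d_string X Y i = Lz \<longrightarrow> e i \<in> {Alpha, Beta})" if "i \<in> {1..m}" for i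
    using e that unfolding is_completion_def Let_def by blast
  have s: "e (csuc m i) = (if d_string X Y (csuc m i) = Lz then next_letter (e i)
      else d_string X Y (csuc m i))" if "i \<in> {1..m}" for i
    using completion_step[OF e m csuc_in[OF that]] pred_csuc[OF that] by simp
  have "completed m e"
    unfolding completed_def
  proof (intro conjI ballI impI ext)
    fix i assume i: "i \<in> {1..m}"
    show "e i \<noteq> Lz" using l[OF i] by (cases "d_string X Y i") (auto simp: d_string_def split: if_splits)
    show "e (csuc m i) = next_letter (e i)" if "e (csuc m i) \<in> {Alpha, Beta}"
      using s[OF i] that by (auto simp: d_string_def split: if_splits)
  qed
  moreover have "(e i = Lx \<longleftrightarrow> i \<in> X) \<and> (e i = Ly \<longleftrightarrow> i \<in> Y)" if "i \<in> {1..m}" for i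
    using l[OF that] XY(3) by (cases "i \<in> X"; cases "i \<in> Y") (auto simp: d_string_def)
  then have "X = occ m e Lx" "Y = occ m e Ly"
    using XY(1,2) unfolding occ_def by blast+
  ultimately show thesis by (rule that)
qed

lemma sgn_pair_completed:
  assumes "completed m e" "m \<ge> 1" "(occ m e Lx, occ m e Ly) \<noteq> ({}, {})"
  shows "sgn_pair m (occ m e Lx) (occ m e Ly) = {l \<in> {Alpha, Beta}. odd (card (occ m e l))}"
proof -
  have sub: "occ m e Lx \<subseteq> {1..m}" "occ m e Ly \<subseteq> {1..m}" by (auto simp: occ_def)
  have "completion m (occ m e Lx) (occ m e Ly) = e"
    using ex1_completion[OF sub assms(3)] is_completion_completion[OF sub assms(3)]
      is_completion_completed[OF assms(1,2)] by blast
  then show ?thesis by (simp add: sgn_pair_def occ_def)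
qed

lemma card_occ:
  assumes "completed m e"
  shows "card (occ m e Lx) + card (occ m e Ly) + card (occ m e Alpha) + card (occ m e Beta) = m"
proof -
  have "{1..m} = (\<Union>l\<in>{Lx, Ly, Alpha, Beta}. occ m e l)"
  proof (intro equalityI subsetI)
    fix i assume i: "i \<in> {1..m}"
    then show "i \<in> (\<Union>l\<in>{Lx, Ly, Alpha, Beta}. occ m e l)"
      using completed_not_Lz[OF assms i] by (cases "e i") (auto simp: occ_def)
  qed (auto simp: occ_def)
  then have "m = card (\<Union>l\<in>{Lx, Ly, Alpha, Beta}. occ m e l)" by (metis card_atLeastAtMost diff_Suc_1)
  also have "\<dots> = (\<Sum>l\<in>{Lx, Ly, Alpha, Beta}. card (occ m e l))"
    by (rule card_UN_disjoint) (auto simp: occ_def)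
  finally show ?thesis by simp
qed

text \<open>The positions of x and y together make up an even number, so an odd number of the m
  positions carries \<alpha> or \<beta>.\<close>

lemma odd_card_occ:
  assumes "completed m e" "odd m" "card (occ m e Lx) = card (occ m e Ly)"
  shows "odd (card (occ m e Alpha)) \<noteq> odd (card (occ m e Beta))"
proof -
  have "odd (2 * card (occ m e Ly) + (card (occ m e Alpha) + card (occ m e Beta)))"
    using card_occ[OF assms(1)] assms(2,3) by (simp add: mult_2 add.assoc)
  then show ?thesis by simp
qed

lemma sgn_pair_eq_Beta:
  assumes "completed m e" "odd m" "card (occ m e Lx) = card (occ m e Ly)" "occ m e Ly \<noteq> {}"
  shows "sgn_pair m (occ m e Lx) (occ m e Ly) = {Beta} \<longleftrightarrow> odd (card (occ m e Beta))"
proof -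
  have "m \<ge> 1" using assms(2) by (cases m) auto
  moreover have "odd (card (occ m e Alpha)) \<noteq> odd (card (occ m e Beta))"
    by (rule odd_card_occ[OF assms(1-3)])
  ultimately show ?thesis using sgn_pair_completed[OF assms(1)] assms(4) by auto
qed

section \<open>Exchanging x with y and \<alpha> with \<beta>\<close>

primrec swap_letter :: "letter \<Rightarrow> letter" where
  "swap_letter Lx = Ly"
| "swap_letter Ly = Lx"
| "swap_letter Lz = Lz"
| "swap_letter Alpha = Beta"
| "swap_letter Beta = Alpha"

text \<open>Swapping letters commutes with \<open>next_letter\<close>, so it yields the completed
  string of the exchanged pair, in which \<beta> stands where \<alpha> stood. By
  \<open>odd_card_occ\<close> exactly one of the two counts is odd.\<close>

lemma sgn_pair_swap:
  assumes XY: "X \<subseteq> {1..m}" "Y \<subseteq> {1..m}" "X \<inter> Y = {}" "card X = card Y" "X \<noteq> {}" and m: "odd m"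
  shows "sgn_pair m Y X = {Beta} \<longleftrightarrow> sgn_pair m X Y \<noteq> {Beta}"
proof -
  obtain e where e: "completed m e" "X = occ m e Lx" "Y = occ m e Ly"
    using ex_completed[OF XY(1-3)] XY(5) by blast
  define f where "f = (\<lambda>i\<in>{1..m}. swap_letter (e i))"
  have sw: "swap_letter (next_letter l) = next_letter (swap_letter l)" for l by (cases l) auto
  have swi: "swap_letter l = k \<longleftrightarrow> l = swap_letter k" for l k by (cases l; cases k) auto
  have "completed m f"
    unfolding completed_def
  proof (intro conjI ballI impI)
    fix i assume i: "i \<in> {1..m}"
    show "f i \<noteq> Lz" using completed_not_Lz[OF e(1) i] i by (auto simp: f_def swi)
    assume "f (csuc m i) \<in> {Alpha, Beta}"
    then have "e (csuc m i) \<in> {Alpha, Beta}" using csuc_in[OF i] by (auto simp: f_def swi simp del: atLeastAtMost_iff)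
    from completed_csuc[OF e(1) i this] show "f (csuc m i) = next_letter (f i)"
      using i csuc_in[OF i] by (simp add: f_def sw del: atLeastAtMost_iff)
  qed (simp add: f_def)
  moreover have occ: "occ m f l = occ m e (swap_letter l)" for l
    by (auto simp: occ_def f_def swi)
  moreover have "Y \<noteq> {}" using XY by (metis card_0_eq card.empty finite_atLeastAtMost finite_subset)
  ultimately have "sgn_pair m Y X = {Beta} \<longleftrightarrow> odd (card (occ m e Alpha))"
    using sgn_pair_eq_Beta[of m f] XY m e by simp
  moreover have "sgn_pair m X Y = {Beta} \<longleftrightarrow> odd (card (occ m e Beta))"
    using sgn_pair_eq_Beta[of m e] XY(4) m e \<open>Y \<noteq> {}\<close> by simp
  moreover have "odd (card (occ m e Alpha)) \<noteq> odd (card (occ m e Beta))"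
    using odd_card_occ[OF e(1) m] XY(4) e by blast
  ultimately show ?thesis by simp
qed

text \<open>A change at one position touches only the transitions into and out of it, which are
  \<open>pre\<close> and \<open>suc\<close>. Writing the position as a successor gives a name to its
  predecessor.\<close>

lemma completed_upd:
  assumes e: "completed m e" and m: "m \<ge> 2" and j: "j \<in> {1..m}" and c: "c \<noteq> Lz"
    and pre: "c \<in> {Alpha, Beta} \<Longrightarrow> c = next_letter (e j)"
    and suc: "e (csuc m (csuc m j)) \<in> {Alpha, Beta} \<Longrightarrow> e (csuc m (csuc m j)) = next_letter c"
  shows "completed m (e(csuc m j := c))"
  unfolding completed_def
proof (intro conjI ballI impI)
  let ?p = "csuc m j"
  have p: "?p \<in> {1..m}" by (rule csuc_in[OF j])
  show "e(?p := c) \<in> {1..m} \<rightarrow>\<^sub>E UNIV" using e p by (auto simp: completed_def PiE_def extensional_def)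
  fix i assume i: "i \<in> {1..m}"
  show "(e(?p := c)) i \<noteq> Lz" using completed_not_Lz[OF e i] c by simp
  assume *: "(e(?p := c)) (csuc m i) \<in> {Alpha, Beta}"
  consider "i = ?p" | "csuc m i = ?p" "i \<noteq> ?p" | "i \<noteq> ?p" "csuc m i \<noteq> ?p" by blast
  then show "(e(?p := c)) (csuc m i) = next_letter ((e(?p := c)) i)"
  proof cases
    case 1
    then show ?thesis using * suc csuc_neq[OF m p] by auto
  next
    case 2
    then have "i = j" using csuc_inj i j by blast
    then show ?thesis using * pre 2 by auto
  next
    case 3
    then show ?thesis using completed_csuc[OF e i] * by auto
  qed
qed

lemma occ_upd: "p \<in> {1..m} \<Longrightarrow> occ m (e(p := c)) l = (if l = c then insert p (occ m e l) else occ m e l - {p})"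
  by (auto simp: occ_def)


section \<open>Rotations\<close>

lemma cadd_mod: "x \<ge> 1 \<Longrightarrow> cadd m x (q mod m) = cadd m x q"
  by (cases x) (simp_all add: cadd_def mod_add_right_eq)

lemma card_shift: "X \<subseteq> {1..m} \<Longrightarrow> card (shift m X q) = card X"
  unfolding shift_def
  by (rule card_image) (rule inj_on_subset[OF bij_betw_imp_inj_on[OF cadd_bij]])

lemma shift_shift: "X \<subseteq> {1..m} \<Longrightarrow> shift m (shift m X q) r = shift m X (q + r)"
  unfolding shift_def image_image by (intro image_cong) (auto intro!: cadd_cadd)

lemma shift_mult: "X \<subseteq> {1..m} \<Longrightarrow> shift m X (m * k) = X"
  unfolding shift_def by (auto simp: cadd_mult subset_iff image_iff)

text \<open>The natural number \<open>m * q - q\<close> plays the role of -q modulo m.\<close>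

lemma shift_inverse:
  assumes "X \<subseteq> {1..m}" "m \<ge> 1"
  shows "shift m (shift m X q) (m * q - q) = X"
proof -
  have "q \<le> m * q" using assms(2) by simp
  then show ?thesis using assms(1) by (simp add: shift_shift shift_mult)
qed

lemma rho_inverse:
  assumes "J \<subseteq> base_set m" "m \<ge> 1"
  shows "(rho m ^^ q) ` (rho m ^^ (m * q - q)) ` J = J"
proof -
  have "q \<le> m * q" using assms(2) by simp
  then have "(rho m ^^ q) ` (rho m ^^ (m * q - q)) ` J = (rho m ^^ (m * q)) ` J"
    by (simp add: image_comp flip: funpow_add)
  also have "\<dots> = map_sum (\<lambda>x. cadd m x (m * q)) (\<lambda>x. cadd m x (m * q)) ` J"
    by (rule rho_funpow[OF assms(1)])
  also have "\<dots> = id ` J"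
  proof (rule image_cong[OF refl])
    fix s assume "s \<in> J"
    then have "s \<in> base_set m" using assms(1) by blast
    then show "map_sum (\<lambda>x. cadd m x (m * q)) (\<lambda>x. cadd m x (m * q)) s = id s"
      unfolding base_set_def by (elim PlusE) (auto simp: cadd_mult)
  qed
  finally show ?thesis by simp
qed

text \<open>Freeing the exponent from the range \<open>{1..m}\<close> allows rotations to be
  composed and inverted without reduction.\<close>

lemma mem_rot_closure:
  assumes "\<A> \<subseteq> Pow (base_set m)" "m \<ge> 1"
  shows "S \<in> rot_closure m \<A> \<longleftrightarrow> (\<exists>q. \<exists>K\<in>\<A>. S = (rho m ^^ q) ` K)"
proof
  assume "\<exists>q. \<exists>K\<in>\<A>. S = (rho m ^^ q) ` K"
  then obtain q K where K: "K \<in> \<A>" "S = (rho m ^^ q) ` K" by blast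
  then have KE: "K \<subseteq> base_set m" using assms(1) by blast
  \<comment> \<open>The exponent 0 lies outside \<open>{1..m}\<close>; its representative there is
    m.\<close>
  define r where "r = (if q mod m = 0 then m else q mod m)"
  have "r mod m = q mod m" by (simp add: r_def)
  then have r: "cadd m x r = cadd m x q" if "x \<ge> 1" for x
    using that by (metis cadd_mod)
  have "(rho m ^^ r) ` K = S"
    unfolding K(2) rho_funpow[OF KE]
  proof (rule image_cong[OF refl])
    fix s assume "s \<in> K"
    then have "s \<in> base_set m" using KE by blast
    then show "map_sum (\<lambda>x. cadd m x r) (\<lambda>x. cadd m x r) s = map_sum (\<lambda>x. cadd m x q) (\<lambda>x. cadd m x q) s"
      unfolding base_set_def by (elim PlusE) (auto simp: r)
  qed
  moreover have "r \<in> {1..m}" using assms(2) by (auto simp: r_def Suc_le_eq intro: less_imp_le)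
  ultimately show "S \<in> rot_closure m \<A>" using K(1) unfolding rot_closure_def by blast
qed (auto simp: rot_closure_def)

text \<open>Presents the orbit, which is defined by rotating single blocks, as the union of the
  rotated boxes. For the converse inclusion the block is rotated back into the original box.\<close>

lemma mem_box_orbit:
  assumes XY: "X \<subseteq> {1..m}" "Y \<subseteq> {1..m}" and m: "m \<ge> 1"
  shows "J \<in> box_orbit m X Y \<longleftrightarrow> (\<exists>q. J \<in> box m (shift m X q) (shift m Y q))"
proof
  assume "J \<in> box_orbit m X Y"
  then show "\<exists>q. J \<in> box m (shift m X q) (shift m Y q)"
    unfolding box_orbit_def rot_closure_def using rho_box[OF _ XY] by blast
next
  assume "\<exists>q. J \<in> box m (shift m X q) (shift m Y q)"
  then obtain q where q: "J \<in> box m (shift m X q) (shift m Y q)" by blast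
  have K: "(rho m ^^ (m * q - q)) ` J \<in> box m X Y"
    using rho_box[OF q shift_subset shift_subset, OF XY, of "m * q - q"] shift_inverse[OF _ m] XY
    by simp
  have J: "J = (rho m ^^ q) ` (rho m ^^ (m * q - q)) ` J"
    using q m by (intro rho_inverse[symmetric]) (simp_all add: mem_box)
  have sub: "box m X Y \<subseteq> Pow (base_set m)" by (auto simp: mem_box)
  show "J \<in> box_orbit m X Y"
    unfolding box_orbit_def mem_rot_closure[OF sub m] by (intro exI bexI) (rule J, rule K)
qed

lemma box_orbit_shift:
  assumes XY: "X \<subseteq> {1..m}" "Y \<subseteq> {1..m}" and m: "m \<ge> 1"
  shows "box_orbit m (shift m X q) (shift m Y q) = box_orbit m X Y"
proof -
  have *: "box_orbit m (shift m U r) (shift m V r) \<subseteq> box_orbit m U V"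
    if UV: "U \<subseteq> {1..m}" "V \<subseteq> {1..m}" for U V r
  proof
    fix J assume "J \<in> box_orbit m (shift m U r) (shift m V r)"
    then obtain q where "J \<in> box m (shift m (shift m U r) q) (shift m (shift m V r) q)"
      using mem_box_orbit[OF shift_subset[OF UV(1)] shift_subset[OF UV(2)] m] by blast
    then show "J \<in> box_orbit m U V"
      unfolding shift_shift[OF UV(1)] shift_shift[OF UV(2)]
      using mem_box_orbit[OF UV m] by blast
  qed
  show ?thesis
    using *[OF XY, of q] *[OF shift_subset[OF XY(1), of q] shift_subset[OF XY(2), of q], of "m * q - q"]
    unfolding shift_inverse[OF XY(1) m] shift_inverse[OF XY(2) m] by (rule antisym)
qed

lemma box_orbit_eq_iff:
  assumes "X \<subseteq> {1..m}" "Y \<subseteq> {1..m}" "X \<inter> Y = {}" "m \<ge> 1" "U \<subseteq> {1..m}" "V \<subseteq> {1..m}"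
  shows "box_orbit m X Y = box_orbit m U V \<longleftrightarrow> (\<exists>q. X = shift m U q \<and> Y = shift m V q)"
  using box_orbit_eqD[OF assms] box_orbit_shift[OF assms(5,6,4)] by blast


section \<open>The exceptional orbits\<close>

text \<open>The equation between unordered pairs admits both orders of \<open>C_set m\<close> and
  its shift, so the two excluded orbits are treated at once.\<close>

definition exceptional :: "nat \<Rightarrow> nat set \<Rightarrow> nat set \<Rightarrow> bool" where
  "exceptional m X Y \<longleftrightarrow> (\<exists>q P R. {P, R} = {C_set m, shift m (C_set m) 1} \<and>
     X = shift m P q \<and> Y = shift m R q)"

lemma exceptional_swap: "exceptional m X Y \<longleftrightarrow> exceptional m Y X"
  unfolding exceptional_def by (metis insert_commute)

lemma C_set_subset: "C_set m \<subseteq> {1..m}"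
  by (auto simp: C_set_def)

lemma shift_C_set: "odd m \<Longrightarrow> shift m (C_set m) 1 = {k \<in> {1..m - 1}. even k}"
proof (intro equalityI subsetI)
  assume m: "odd m"
  fix k assume "k \<in> {k \<in> {1..m - 1}. even k}"
  then have k: "1 \<le> k" "k \<le> m - 1" "even k" by auto
  then have "k \<noteq> 1" by auto
  with k have "k - 1 \<in> C_set m" "cadd m (k - 1) 1 = k" by (auto simp: C_set_def cadd_def)
  then show "k \<in> shift m (C_set m) 1" unfolding shift_def by (metis imageI)
qed (auto simp: C_set_def shift_def cadd_def)

text \<open>Going through the numbers below m, the two sets alternate by parity, and only m belongs
  to neither. Hence neither contains two cyclically consecutive positions.\<close>

lemma C_set_pair:
  assumes "odd m" "m \<ge> 3" "{P, R} = {C_set m, shift m (C_set m) 1}"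
  shows "P \<subseteq> {1..m}" "m \<notin> P" "P \<noteq> {}" "P \<inter> R = {}" "2 * card P + 1 = m" "P \<union> R = {1..m} - {m}"
    "i \<in> P \<Longrightarrow> csuc m i \<notin> P"
proof -
  have PR: "(P = C_set m \<and> R = shift m (C_set m) 1) \<or> (R = C_set m \<and> P = shift m (C_set m) 1)"
    using assms(3) by (auto simp: doubleton_eq_iff)
  note S = shift_C_set[OF assms(1)]
  show sub: "P \<subseteq> {1..m}" using PR C_set_subset shift_subset[OF C_set_subset] by metis
  have mC: "m \<notin> C_set m" "m \<notin> shift m (C_set m) 1" "C_set m \<inter> shift m (C_set m) 1 = {}"
    unfolding S using assms(2) by (auto simp: C_set_def)
  show "m \<notin> P" using mC(1,2) PR by blast
  show "P \<inter> R = {}" using mC(3) PR by blast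
  show c: "2 * card P + 1 = m"
    using PR card_C_set[OF assms(1)] card_shift[OF C_set_subset, of m 1] by auto
  show "P \<noteq> {}" using c assms(2) by auto
  have "k \<in> C_set m \<or> k \<in> shift m (C_set m) 1" if "k \<in> {1..m} - {m}" for k
  proof (cases "odd k")
    case True
    have "k \<noteq> m - 1" using True assms by auto
    then show ?thesis using that True by (auto simp: C_set_def)
  qed (use that in \<open>unfold S, auto\<close>)
  moreover have "C_set m \<subseteq> {1..m} - {m}" "shift m (C_set m) 1 \<subseteq> {1..m} - {m}"
    unfolding S using assms(2) by (auto simp: C_set_def)
  ultimately show "P \<union> R = {1..m} - {m}" using PR by blast
  have c1: "i < m \<Longrightarrow> csuc m i = Suc i"
    by (simp add: csuc_def cadd_def)
  have cC: "csuc m i \<notin> C_set m" if "i \<in> C_set m"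
  proof -
    have "i < m" using that by (auto simp: C_set_def)
    then show ?thesis using c1 that by (simp add: C_set_def)
  qed
  have cD: "csuc m i \<notin> shift m (C_set m) 1" if "i \<in> shift m (C_set m) 1"
  proof -
    have "i < m" "even i" using that assms(2) unfolding S by auto
    then show ?thesis using c1 unfolding S by simp
  qed
  show "csuc m i \<notin> P" if "i \<in> P" using that cC cD PR by blast
qed

text \<open>These rotation-invariant properties of \<open>C_set_pair\<close> are what the later
  counting uses. There is exactly one free position because X and Y have (m - 1)/2 elements
  each.\<close>

lemma exceptional_props:
  assumes "exceptional m X Y" "odd m" "m \<ge> 3"
  shows "x \<in> X \<Longrightarrow> csuc m x \<notin> X" "y \<in> Y \<Longrightarrow> csuc m y \<notin> Y"
    "\<exists>h. {1..m} - (X \<union> Y) = {h}" "X \<noteq> {}"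
proof -
  obtain q P R where PR: "{P, R} = {C_set m, shift m (C_set m) 1}"
    and X: "X = shift m P q" and Y: "Y = shift m R q"
    using assms(1) unfolding exceptional_def by blast
  have RP: "{R, P} = {C_set m, shift m (C_set m) 1}" using PR by (simp add: insert_commute)
  note P = C_set_pair[OF assms(2,3) PR] and R = C_set_pair[OF assms(2,3) RP]
  have *: "csuc m x \<notin> shift m U q"
    if U: "U \<subseteq> {1..m}" "x \<in> shift m U q" "\<And>i. i \<in> U \<Longrightarrow> csuc m i \<notin> U" for U x
  proof -
    obtain i where i: "i \<in> U" "x = cadd m i q" using U(2) unfolding shift_def by blast
    then have "i \<in> {1..m}" using U(1) by blast
    then show ?thesis
      using cadd_mem_shift[OF U(1) csuc_in] U(3)[OF i(1)] by (simp add: i(2) csuc_cadd)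
  qed
  show "csuc m x \<notin> X" if "x \<in> X"
    using *[OF P(1) that[unfolded X] P(7)] X by simp
  show "csuc m y \<notin> Y" if "y \<in> Y"
    using *[OF R(1) that[unfolded Y] R(7)] Y by simp
  show "X \<noteq> {}" using P(3) by (simp add: X shift_def)
  have "card (X \<union> Y) = card X + card Y"
  proof (rule card_Un_disjoint)
    show "finite X" "finite Y" using finite_subset[OF P(1)] finite_subset[OF R(1)] by (simp_all add: X Y shift_def)
    show "X \<inter> Y = {}"
      using inj_on_image_Int[OF bij_betw_imp_inj_on[OF cadd_bij] P(1) R(1)] P(4) by (simp add: X Y shift_def)
  qed
  then have "card ({1..m} - (X \<union> Y)) = 1"
    using card_shift[OF P(1), of q] card_shift[OF R(1), of q] P(5) R(5)
      shift_subset[OF P(1), of q] shift_subset[OF R(1), of q]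
    by (subst card_Diff_subset) (auto simp: X Y intro: finite_subset)
  then show "\<exists>h. {1..m} - (X \<union> Y) = {h}" by (simp add: card_1_singleton_iff)
qed


section \<open>Blocks among the sets of middle size\<close>

lemma box_eqI:
  assumes "J \<in> box m X Y" "K \<in> box m X Y" "\<And>z. z \<in> {1..m} - (X \<union> Y) \<Longrightarrow> Inl z \<in> J \<longleftrightarrow> Inl z \<in> K"
  shows "J = K"
proof (rule set_eqI)
  fix s
  have sub: "J \<subseteq> base_set m" "K \<subseteq> base_set m" using assms by (auto simp: mem_box)
  have *: "(Inl z \<in> J \<longleftrightarrow> Inl z \<in> K) \<and> (Inr z \<in> J \<longleftrightarrow> Inr z \<in> K)" if "z \<in> {1..m}" for z
    using that assms unfolding mem_box by blast
  show "s \<in> J \<longleftrightarrow> s \<in> K"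
    using sub * by (cases s) (auto simp: base_set_def simp del: atLeastAtMost_iff)
qed

text \<open>An exceptional box has only two members, which differ at the single free position. The
  rotations of A_m and B_m are the members that contain this position unprimed.\<close>

lemma mem_rot_closure_A_B:
  assumes m: "odd m" "m \<ge> 3" and T: "T \<in> box m X Y" and XY: "X \<subseteq> {1..m}" "Y \<subseteq> {1..m}"
  shows "T \<in> rot_closure m {A_block m, B_block m} \<longleftrightarrow>
    exceptional m X Y \<and> (\<exists>h\<in>{1..m} - (X \<union> Y). Inl h \<in> T)"
proof -
  let ?C = "C_set m" and ?D = "shift m (C_set m) 1"
  \<comment> \<open>\<open>K P\<close> is B_m if P is \<open>C_set m\<close>, and A_m if P is its
    shift.\<close>
  define K where "K P = insert (Inl m) (P <+> P)" for P :: "nat set"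
  have AB: "{A_block m, B_block m} = {K P | P R. {P, R} = {?C, ?D}}"
    by (auto simp: A_block_def B_block_def K_def doubleton_eq_iff)
  have m1: "m \<ge> 1" "m \<in> {1..m}" using m by auto
  have Kbox: "K P \<in> box m P R" if "{P, R} = {?C, ?D}" for P R
    using C_set_pair(1,2,4,6)[OF m that] m1 unfolding mem_box K_def
    by (auto simp: base_set_def)
  have rotK: "(rho m ^^ q) ` K P \<in> box m (shift m P q) (shift m R q)"
    "Inl (cadd m m q) \<in> (rho m ^^ q) ` K P"
    "cadd m m q \<in> {1..m} - (shift m P q \<union> shift m R q)"
    if PR: "{P, R} = {?C, ?D}" for P R q
  proof -
    have RP: "{R, P} = {?C, ?D}" using PR by (simp add: insert_commute)
    note P = C_set_pair(1,2)[OF m PR] and R = C_set_pair(1,2)[OF m RP]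
    show "(rho m ^^ q) ` K P \<in> box m (shift m P q) (shift m R q)"
      by (rule rho_box[OF Kbox[OF PR] P(1) R(1)])
    have "K P \<subseteq> base_set m" using Kbox[OF PR] by (simp add: mem_box)
    then show "Inl (cadd m m q) \<in> (rho m ^^ q) ` K P"
      by (subst rho_funpow) (auto simp: K_def)
    show "cadd m m q \<in> {1..m} - (shift m P q \<union> shift m R q)"
      using cadd_mem_shift[OF P(1) m1(2)] cadd_mem_shift[OF R(1) m1(2)] P(2) R(2) cadd_in[OF m1(1)]
      by blast
  qed
  have sub: "{A_block m, B_block m} \<subseteq> Pow (base_set m)"
  proof
    fix S assume "S \<in> {A_block m, B_block m}"
    then obtain P R where "{P, R} = {?C, ?D}" "S = K P" unfolding AB by blast
    then show "S \<in> Pow (base_set m)" using Kbox[of P R] by (simp add: mem_box)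
  qed
  have rot: "T \<in> rot_closure m {A_block m, B_block m} \<longleftrightarrow>
      (\<exists>q P R. {P, R} = {?C, ?D} \<and> T = (rho m ^^ q) ` K P)"
    unfolding mem_rot_closure[OF sub m1(1)] unfolding AB by auto
  show ?thesis
  proof
    assume "T \<in> rot_closure m {A_block m, B_block m}"
    then obtain q P R where PR: "{P, R} = {?C, ?D}" and Teq: "T = (rho m ^^ q) ` K P"
      unfolding rot by blast
    have PR': "P \<subseteq> {1..m}" "R \<subseteq> {1..m}"
      using C_set_pair(1)[OF m PR] C_set_pair(1)[OF m, of R P] PR by (simp_all add: insert_commute)
    have T': "T \<in> box m (shift m P q) (shift m R q)" using rotK(1)[OF PR] Teq by simp
    have "X = shift m P q" "Y = shift m R q"
      using box_determines[OF T XY] box_determines[OF T' shift_subset shift_subset, OF PR']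
      by (simp_all only:)
    then show "exceptional m X Y \<and> (\<exists>h\<in>{1..m} - (X \<union> Y). Inl h \<in> T)"
      using PR rotK(2,3)[OF PR, of q] unfolding exceptional_def Teq by blast
  next
    assume R: "exceptional m X Y \<and> (\<exists>h\<in>{1..m} - (X \<union> Y). Inl h \<in> T)"
    then obtain q P R where PR: "{P, R} = {?C, ?D}" and X: "X = shift m P q" and Y: "Y = shift m R q"
      unfolding exceptional_def by blast
    obtain h where h: "{1..m} - (X \<union> Y) = {h}" using exceptional_props(3)[OF _ m] R by blast
    \<comment> \<open>The free position of \<open>K P\<close> is m, so after rotation it must be the
      unique free position h.\<close>
    have "cadd m m q = h" using rotK(3)[OF PR, of q] h unfolding X Y by blast
    then have "Inl h \<in> (rho m ^^ q) ` K P" "Inl h \<in> T" using rotK(2)[OF PR, of q] R h by auto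
    then have "T = (rho m ^^ q) ` K P"
      using rotK(1)[OF PR, of q] h unfolding X[symmetric] Y[symmetric] by (intro box_eqI[OF T]) auto
    then show "T \<in> rot_closure m {A_block m, B_block m}"
      unfolding rot using PR by blast
  qed
qed

text \<open>A block determines its pair (X, Y), so the only member of \<open>Omega m\<close> that
  can contain it is the orbit of that pair.\<close>

lemma mem_Union_Omega:
  assumes m: "odd m" "m \<ge> 3" and T: "T \<in> box m X Y"
    and XY: "X \<subseteq> {1..m}" "Y \<subseteq> {1..m}" "X \<inter> Y = {}" "card X = card Y"
  shows "T \<in> \<Union> {Q \<in> Omega m - {box_orbit m (C_set m) (shift m (C_set m) 1),
                        box_orbit m (shift m (C_set m) 1) (C_set m)}. sgn_orbit m Q = {Beta}} \<longleftrightarrow>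
    X \<noteq> {} \<and> \<not> exceptional m X Y \<and> sgn_pair m X Y = {Beta}"
    (is "_ \<in> \<Union> {Q \<in> _ - ?exc. _} \<longleftrightarrow> _")
proof -
  have m1: "m \<ge> 1" using m by simp
  have C: "C_set m \<subseteq> {1..m}" "shift m (C_set m) 1 \<subseteq> {1..m}"
    using C_set_subset shift_subset[OF C_set_subset] by auto
  have Q: "Q = box_orbit m X Y" if QO: "Q \<in> Omega m" and TQ: "T \<in> Q" for Q
  proof -
    obtain U V where UV: "U \<subseteq> {1..m}" "V \<subseteq> {1..m}" and Q: "Q = box_orbit m U V"
      using QO unfolding Omega_def by blast
    obtain q where q: "T \<in> box m (shift m U q) (shift m V q)"
      using TQ mem_box_orbit[OF UV m1] unfolding Q by blast
    have "X = shift m U q" "Y = shift m V q"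
      using box_determines[OF T XY(1,2)] box_determines[OF q shift_subset shift_subset, OF UV]
      by (simp_all only:)
    then show ?thesis using box_orbit_shift[OF UV m1] Q by simp
  qed
  have TXY: "T \<in> box_orbit m X Y" using box_subset_orbit[OF m1] T by blast
  have e0: "box_orbit m X Y = box_orbit m {} {} \<longleftrightarrow> X = {}"
    using box_orbit_eq_iff[OF XY(1-3) m1, of "{}" "{}"] XY finite_subset[OF XY(2)]
    by (auto simp: shift_def)
  have e1: "box_orbit m X Y \<in> ?exc \<longleftrightarrow> exceptional m X Y"
    using box_orbit_eq_iff[OF XY(1-3) m1 C] box_orbit_eq_iff[OF XY(1-3) m1 C(2,1)]
    unfolding exceptional_def by (auto simp: doubleton_eq_iff)
  have "box_orbit m X Y \<in> Omega m \<longleftrightarrow> X \<noteq> {}"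
    using XY e0 unfolding Omega_def by blast
  then have "T \<in> \<Union> {Q \<in> Omega m - ?exc. sgn_orbit m Q = {Beta}} \<longleftrightarrow>
      X \<noteq> {} \<and> \<not> exceptional m X Y \<and> sgn_orbit m (box_orbit m X Y) = {Beta}"
    using Q TXY e1 by blast
  then show ?thesis using sgn_orbit_box_orbit[OF XY(1-3)] by auto
qed

text \<open>The sets \<open>F_block m J\<close> fill the box of two empty sets, and J is recovered
  as the unprimed part. The predicate \<open>P\<close> serves both parities.\<close>

lemma mem_F:
  assumes T: "T \<in> box m X Y" and XY: "X \<subseteq> {1..m}" "Y \<subseteq> {1..m}"
  shows "(\<exists>J. T = F_block m J \<and> J \<subseteq> {1..m} \<and> P (card J)) \<longleftrightarrow>
    X = {} \<and> Y = {} \<and> P (card {k. Inl k \<in> T})"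
proof
  assume "\<exists>J. T = F_block m J \<and> J \<subseteq> {1..m} \<and> P (card J)"
  then obtain J where J: "T = F_block m J" "J \<subseteq> {1..m}" "P (card J)" by blast
  then have "T \<in> box m {} {}" by (auto simp: mem_box F_block_def base_set_def)
  then have "X = {}" "Y = {}"
    using box_determines[OF T XY] box_determines[of T m "{}" "{}"] by simp_all
  moreover have "{k. Inl k \<in> T} = J" using J(1) by (auto simp: F_block_def)
  ultimately show "X = {} \<and> Y = {} \<and> P (card {k. Inl k \<in> T})" using J(3) by simp
next
  assume R: "X = {} \<and> Y = {} \<and> P (card {k. Inl k \<in> T})"
  let ?J = "{k. Inl k \<in> T}"
  have J: "?J \<subseteq> {1..m}" using T by (auto simp: mem_box base_set_def)
  have "F_block m ?J \<in> box m X Y"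
    using R J by (auto simp: mem_box F_block_def base_set_def)
  then have "T = F_block m ?J"
    by (rule box_eqI[OF T]) (auto simp: F_block_def)
  with J R show "\<exists>J. T = F_block m J \<and> J \<subseteq> {1..m} \<and> P (card J)" by blast
qed

text \<open>The three kinds of blocks live in different boxes: the \<open>F_block\<close> sets where
  X and Y are empty, the rotations of A_m and B_m in exceptional boxes, the remaining blocks
  elsewhere. So each case needs only one test.\<close>

lemma mem_S_system:
  assumes m: "odd m" "m \<ge> 3" and T: "T \<in> box m X Y"
    and XY: "X \<subseteq> {1..m}" "Y \<subseteq> {1..m}" "X \<inter> Y = {}" "card X = card Y"
  shows "T \<in> S_system m i \<longleftrightarrow>
    (if X = {} then odd (card {k. Inl k \<in> T}) \<longleftrightarrow> i = 1
     else if exceptional m X Y then \<exists>h\<in>{1..m} - (X \<union> Y). Inl h \<in> T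
     else sgn_pair m X Y = {Beta})"
proof -
  have Y: "Y = {} \<longleftrightarrow> X = {}" using XY finite_subset[OF XY(1)] finite_subset[OF XY(2)] by auto
  have F: "T \<in> (if i = 1 then F1 m else F2 m) \<longleftrightarrow> X = {} \<and> (odd (card {k. Inl k \<in> T}) \<longleftrightarrow> i = 1)"
    using mem_F[OF T XY(1,2), of odd] mem_F[OF T XY(1,2), of even] Y
    by (simp add: F1_def F2_def)
  show ?thesis
    unfolding S_system_def H_system_def Un_iff F mem_rot_closure_A_B[OF m T XY(1,2)] mem_Union_Omega[OF m T XY]
    using exceptional_props(4)[OF _ m] by auto
qed

section \<open>Complements of sets of middle size\<close>

lemma ex_box:
  assumes "T \<subseteq> base_set m"
  obtains X Y where "T \<in> box m X Y" "X \<subseteq> {1..m}" "Y \<subseteq> {1..m}" "X \<inter> Y = {}"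
    "card T + card Y = m + card X"
proof -
  define X where "X = {x\<in>{1..m}. Inl x \<in> T \<and> Inr x \<in> T}"
  define Y where "Y = {y\<in>{1..m}. Inl y \<notin> T \<and> Inr y \<notin> T}"
  have T: "T \<in> box m X Y" using assms by (auto simp: mem_box X_def Y_def)
  have XY: "X \<subseteq> {1..m}" "Y \<subseteq> {1..m}" "X \<inter> Y = {}" by (auto simp: X_def Y_def)
  have fin: "finite X" "finite Y" by (simp_all add: X_def Y_def)
  let ?Z = "{1..m} - (X \<union> Y)"
  have Teq: "T = (\<Union>k\<in>{1..m}. {Inl k, Inr k} \<inter> T)"
    using assms by (auto simp: base_set_def)
  \<comment> \<open>Position k contributes 2, 0 or 1 according as it lies in X, in Y or in
    neither.\<close>
  have "card T = (\<Sum>k\<in>{1..m}. card ({Inl k, Inr k} \<inter> T))"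
    by (subst Teq, rule card_UN_disjoint) auto
  also have "{1..m} = X \<union> (Y \<union> ?Z)" using XY by auto
  also have "(\<Sum>k\<in>X \<union> (Y \<union> ?Z). card ({Inl k, Inr k} \<inter> T)) = 2 * card X + card ?Z"
    using XY(3) fin T by (subst sum.union_disjoint; (subst sum.union_disjoint)?) (auto simp: box_def)
  finally have "card T = 2 * card X + card ?Z" .
  moreover have "card ?Z + (card X + card Y) = m"
    using card_Un_disjoint[OF fin XY(3)] card_Diff_subset[of "X \<union> Y" "{1..m}"]
      card_mono[of "{1..m}" "X \<union> Y"] fin XY by simp
  ultimately have "card T + card Y = m + card X" by simp
  then show thesis using that[OF T XY] by blast
qed

text \<open>Complementing negates each test of \<open>mem_S_system\<close>: the two unprimed parts
  have sizes adding up to the odd number m, the free position changes between unprimed and primed,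
  and the signature is governed by \<open>sgn_pair_swap\<close>.\<close>

lemma S_system_complement:
  assumes m: "odd m" "m \<ge> 3" and T: "T \<subseteq> base_set m" "card T = m"
  shows "base_set m - T \<in> S_system m i \<longleftrightarrow> T \<notin> S_system m i"
proof -
  obtain X Y where B: "T \<in> box m X Y" and XY: "X \<subseteq> {1..m}" "Y \<subseteq> {1..m}" "X \<inter> Y = {}" "card X = card Y"
    using ex_box[OF T(1)] T(2) by (metis add_left_cancel)
  have B': "base_set m - T \<in> box m Y X"
    using B XY unfolding mem_box by (auto simp: base_set_def)
  have YX: "Y \<inter> X = {}" "card Y = card X" using XY by auto
  note mem = mem_S_system[OF m B XY] and mem' = mem_S_system[OF m B' XY(2,1) YX]
  have Y: "Y = {} \<longleftrightarrow> X = {}" using XY finite_subset[OF XY(1)] finite_subset[OF XY(2)] by auto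
  consider "X = {}" | "X \<noteq> {}" "exceptional m X Y" | "X \<noteq> {}" "\<not> exceptional m X Y" by blast
  then show ?thesis
  proof cases
    case 1
    let ?J = "{k. Inl k \<in> T}" and ?K = "{k. Inl k \<in> base_set m - T}"
    have "?J \<inter> ?K = {}" "?J \<union> ?K = {1..m}" using T(1) by (auto simp: base_set_def)
    then have "card ?J + card ?K = m"
      by (metis card_Un_disjoint card_atLeastAtMost diff_Suc_1 finite_Un finite_atLeastAtMost)
    then have "odd (card ?J + card ?K)" using m(1) by simp
    then have "odd (card ?J) \<noteq> odd (card ?K)" unfolding even_add by blast
    then show ?thesis using 1 Y mem mem' by auto
  next
    case 2
    obtain h where h: "{1..m} - (X \<union> Y) = {h}" using exceptional_props(3)[OF 2(2) m] by blast
    then have "h \<in> {1..m}" by blast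
    then have "Inl h \<in> base_set m" unfolding base_set_def by (rule InlI)
    then show ?thesis using 2 Y mem mem' h exceptional_swap[of m X Y] by (simp add: Un_commute)
  next
    case 3
    then show ?thesis using sgn_pair_swap[OF XY 3(1) m(1)] Y mem mem' exceptional_swap[of m X Y] by simp
  qed
qed


section \<open>Blocks inside larger sets\<close>

text \<open>Otherwise the cyclic walk from y would never enter X, although it visits every
  position.\<close>

lemma ex_csuc_entry:
  assumes "X \<subseteq> {1..m}" "x \<in> X" "y \<in> {1..m}" "y \<notin> X"
  obtains j where "j \<in> {1..m}" "j \<notin> X" "csuc m j \<in> X"
proof -
  have "\<exists>j\<in>{1..m}. j \<notin> X \<and> csuc m j \<in> X"
  proof (rule ccontr)
    assume *: "\<not> ?thesis"
    have "m \<ge> 1" using assms(3) by simp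
    have "cadd m y k \<notin> X" for k
    proof (induction k)
      case 0
      then show ?case using assms by (simp add: cadd_0)
    next
      case (Suc k)
      have "cadd m y (Suc k) = csuc m (cadd m y k)"
        using assms(3) by (simp add: csuc_def cadd_cadd)
      then show ?case using * Suc cadd_in[OF \<open>m \<ge> 1\<close>] by metis
    qed
    moreover obtain k where "x = cadd m y k" using cadd_reach[OF assms(3)] assms(1,2) by blast
    ultimately show False using assms(2) by blast
  qed
  then show thesis using that by blast
qed

lemma S_system_block_in_Suc:
  assumes m: "odd m" "m \<ge> 3" and T: "T \<subseteq> base_set m" "card T = Suc m"
  shows "\<exists>S\<in>S_system m i. S \<subseteq> T"
proof -
  obtain X Y where B: "T \<in> box m X Y" and XY: "X \<subseteq> {1..m}" "Y \<subseteq> {1..m}" "X \<inter> Y = {}"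
    and "card T + card Y = m + card X"
    using ex_box[OF T(1)] by blast
  then have card: "card X = Suc (card Y)" using T(2) by simp
  then have X0: "X \<noteq> {}" by auto
  have fin: "finite X" "finite Y" using finite_subset[OF XY(1)] finite_subset[OF XY(2)] by auto
  have m2: "m \<ge> 2" using m by simp
  have remX: "T - {Inl x} \<in> box m (X - {x}) Y" "T - {Inr x} \<in> box m (X - {x}) Y"
    "X - {x} \<subseteq> {1..m}" "(X - {x}) \<inter> Y = {}" "card (X - {x}) = card Y"
    if "x \<in> X" for x
    using that B XY card fin unfolding mem_box by auto
  \<comment> \<open>Exactly one of the two elements at z is in T, so this removes a single
    point.\<close>
  have remZ: "T - {Inl z, Inr z} \<in> box m X (insert z Y)"
    "insert z Y \<subseteq> {1..m}" "X \<inter> insert z Y = {}" "card X = card (insert z Y)"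
    if "z \<in> {1..m} - (X \<union> Y)" for z
    using that B XY card fin unfolding mem_box by auto
  show ?thesis
  proof (cases "Y = {}")
    case True
    \<comment> \<open>Both elements at x are in T. Removing the primed or the unprimed one gives
      unprimed parts of different parity, so one of the results is a block for the given i.\<close>
    then obtain x where x: "X = {x}" using card by (auto simp: card_1_singleton_iff)
    let ?L = "{k. Inl k \<in> T}"
    have "?L \<subseteq> {1..m}" using T(1) by (auto simp: base_set_def)
    then have "finite ?L" by (rule finite_subset) simp
    moreover have "x \<in> ?L" using B x by (simp add: mem_box)
    ultimately have L: "card ?L = Suc (card (?L - {x}))" by (rule card.remove)
    have sets: "{k. Inl k \<in> T - {Inr x}} = ?L" "{k. Inl k \<in> T - {Inl x}} = ?L - {x}" by auto
    have xX: "x \<in> X" using x by simp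
    note mem = mem_S_system[OF m remX(1)[OF xX] remX(3)[OF xX] XY(2) remX(4,5)[OF xX]]
      mem_S_system[OF m remX(2)[OF xX] remX(3)[OF xX] XY(2) remX(4,5)[OF xX]]
    have "T - {Inl x} \<in> S_system m i \<or> T - {Inr x} \<in> S_system m i"
      using x L unfolding mem sets by auto
    then show ?thesis by blast
  next
    case Y0: False
    obtain e where e: "completed m e" and X: "X = occ m e Lx" and Y: "Y = occ m e Ly"
      using ex_completed[OF XY] X0 by blast
    have letter: "(x \<in> X \<longleftrightarrow> e x = Lx) \<and> (x \<in> Y \<longleftrightarrow> e x = Ly)" if "x \<in> {1..m}" for x
      using that by (simp add: X Y occ_def)
    show ?thesis
    proof (rule ccontr)
      assume no: "\<not> ?thesis"
      \<comment> \<open>A move that frees x always yields a block: the primed element is removed, so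
        if the new pair is exceptional, its free position x is still present unprimed.\<close>
      have M1: False
        if x: "x \<in> X" and c: "c \<in> {Alpha, Beta}" and e': "completed m (e(x := c))"
          and odd: "odd (card (occ m (e(x := c)) Beta))" for x c
      proof -
        have x1: "x \<in> {1..m}" using x XY by blast
        have "occ m (e(x := c)) Lx = X - {x}" "occ m (e(x := c)) Ly = Y"
          using c x letter[OF x1] by (auto simp: occ_upd[OF x1] X Y occ_def)
        then have sgn: "sgn_pair m (X - {x}) Y = {Beta}"
          using sgn_pair_eq_Beta[OF e' m(1)] odd remX(5)[OF x] Y0 by simp
        have "X - {x} \<noteq> {}" using remX(5)[OF x] Y0 fin by (metis card_0_eq card.empty)
        note mem = mem_S_system[OF m remX(2)[OF x] remX(3)[OF x] XY(2) remX(4,5)[OF x]]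
        have "Inl x \<in> T - {Inr x}" using B x by (simp add: mem_box)
        moreover have "x \<in> {1..m} - (X - {x} \<union> Y)" using x XY by blast
        ultimately have "T - {Inr x} \<in> S_system m i"
          unfolding mem using sgn \<open>X - {x} \<noteq> {}\<close> by auto
        with no show False by blast
      qed
      \<comment> \<open>Here the free position left by an exceptional pair is not z, and T may
        contain it primed; this is the only way in which the move can fail.\<close>
      have M2: "exceptional m X (insert z Y)"
        if z: "z \<in> {1..m}" "e z \<in> {Alpha, Beta}" and e': "completed m (e(z := Ly))"
          and odd: "odd (card (occ m (e(z := Ly)) Beta))" for z
      proof (rule ccontr)
        assume ne: "\<not> ?thesis"
        have z': "z \<in> {1..m} - (X \<union> Y)" using z letter[OF z(1)] by auto
        have "occ m (e(z := Ly)) Lx = X" "occ m (e(z := Ly)) Ly = insert z Y"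
          using z' by (auto simp: occ_upd[OF z(1)] X Y)
        then have "sgn_pair m X (insert z Y) = {Beta}"
          using sgn_pair_eq_Beta[OF e' m(1)] odd remZ(4)[OF z'] by simp
        then have "T - {Inl z, Inr z} \<in> S_system m i"
          using mem_S_system[OF m remZ(1)[OF z'] XY(1) remZ(2-4)[OF z']] X0 ne by simp
        with no show False by blast
      qed
      show False
      proof (cases "odd (card (occ m e Beta))")
        case True
        \<comment> \<open>After y or \<beta> the x could become \<alpha>, which \<open>M1\<close>
          forbids, so the preceding letter is \<alpha>. It can become y because the x behind it is
          subject to no transition rule.\<close>
        have entry: "e j = Alpha \<and> exceptional m X (insert j Y)"
          if j: "j \<in> {1..m}" "j \<notin> X" "csuc m j \<in> X" for j
        proof -
          have x: "e (csuc m j) = Lx" using letter[OF csuc_in[OF j(1)]] j(3) by simp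
          have "e j \<noteq> Lx" "e j \<noteq> Lz" using letter[OF j(1)] j(2) completed_not_Lz[OF e j(1)] by auto
          moreover have False if "e j \<in> {Ly, Beta}"
          proof (rule M1[OF j(3), of Alpha])
            \<comment> \<open>Both x and \<alpha> force \<beta> as the next letter, so the
              transition out of the position survives.\<close>
            show "completed m (e(csuc m j := Alpha))"
              using completed_csuc[OF e csuc_in[OF j(1)]] that x
              by (intro completed_upd[OF e m2 j(1)]) auto
            have "occ m (e(csuc m j := Alpha)) Beta = occ m e Beta"
              using x by (auto simp: occ_def)
            then show "odd (card (occ m (e(csuc m j := Alpha)) Beta))" using True by simp
          qed simp
          ultimately have a: "e j = Alpha" by (cases "e j") auto
          obtain k where k: "k \<in> {1..m}" "j = csuc m k" using csuc_surj[OF j(1)] .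
          have "exceptional m X (insert j Y)"
          proof (rule M2[OF j(1)])
            show "completed m (e(j := Ly))"
              using x unfolding k(2) by (intro completed_upd[OF e m2 k(1)]) auto
            have "occ m (e(j := Ly)) Beta = occ m e Beta"
              using a by (auto simp: occ_def)
            then show "odd (card (occ m (e(j := Ly)) Beta))" using True by simp
          qed (simp add: a)
          with a show ?thesis by blast
        qed
        obtain x y where xy: "x \<in> X" "y \<in> Y" using X0 Y0 by blast
        then have "y \<in> {1..m}" "y \<notin> X" using XY by auto
        then obtain z where z: "z \<in> {1..m}" "z \<notin> X" "csuc m z \<in> X"
          using ex_csuc_entry[OF XY(1) xy(1)] by blast
        note exc = entry[OF z]
        obtain h where h: "{1..m} - (X \<union> insert z Y) = {h}"
          using exceptional_props(3)[OF _ m] exc by blast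
        \<comment> \<open>X has a second element u. Its predecessor j is outside X by
          exceptionality, hence also carries \<alpha>, and so j is the one free position h left
          beside z.\<close>
        have "X - {csuc m z} \<noteq> {}" using remX(5)[OF z(3)] fin Y0 by (metis card_0_eq card.empty)
        then obtain u where u: "u \<in> X" "u \<noteq> csuc m z" by blast
        have "u \<in> {1..m}" using u(1) XY(1) by blast
        then obtain j where j: "j \<in> {1..m}" "u = csuc m j" using csuc_surj by blast
        have "j \<notin> X" using exceptional_props(1)[OF _ m] exc j(2) u(1) by blast
        then have ej: "e j = Alpha" using entry[OF j(1)] u j by blast
        have "j \<noteq> z" using u(2) j(2) by blast
        then have "j \<notin> X \<union> insert z Y" using ej letter[OF j(1)] by simp
        then have "j = h" using h j(1) by blast
        \<comment> \<open>Outside X and Y only z and h remain, and both carry \<alpha>. This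
          contradicts the odd number of \<beta>.\<close>
        have "i \<notin> occ m e Beta" for i
        proof
          assume "i \<in> occ m e Beta"
          then have i: "i \<in> {1..m}" "e i = Beta" by (auto simp: occ_def)
          then have "i \<notin> X \<union> insert z Y" using exc letter[OF i(1)] by auto
          then have "i = h" using h i(1) by blast
          then show False using \<open>j = h\<close> ej i(2) by simp
        qed
        then have "occ m e Beta = {}" by blast
        with True show False by simp
      next
        case even: False
        show False
        proof (cases "occ m e Beta = {}")
          case none: True
          \<comment> \<open>Without \<beta>, an x can be followed only by x or y. If it were always
            y, the injective successor map would send X into the smaller set Y.\<close>
          have "\<exists>x\<in>X. csuc m x \<in> X"
          proof (rule ccontr)
            assume *: "\<not> ?thesis"
            have "csuc m ` X \<subseteq> Y"
            proof (intro image_subsetI)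
              fix x assume x: "x \<in> X"
              then have x1: "x \<in> {1..m}" using XY by blast
              have "e (csuc m x) \<noteq> Beta" using none csuc_in[OF x1] by (auto simp: occ_def)
              then have "e (csuc m x) \<notin> {Alpha, Beta}"
                using completed_csuc[OF e x1] letter[OF x1] x by auto
              then have "e (csuc m x) = Ly"
                using * x letter[OF csuc_in[OF x1]] completed_not_Lz[OF e csuc_in[OF x1]]
                by (cases "e (csuc m x)") auto
              then show "csuc m x \<in> Y" using letter[OF csuc_in[OF x1]] by blast
            qed
            then have "card X \<le> card Y"
              using card_inj_on_le[OF inj_on_subset[OF inj_on_csuc XY(1)]] fin by blast
            then show False using card by simp
          qed
          then obtain x where x: "x \<in> X" "csuc m x \<in> X" by blast
          then have x1: "x \<in> {1..m}" using XY by blast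
          have ex: "e x = Lx" "e (csuc m x) = Lx"
            using letter[OF x1] letter[OF csuc_in[OF x1]] x by auto
          have noB: "e i \<noteq> Beta" if "i \<in> {1..m}" for i using none that by (auto simp: occ_def)
          show False
          proof (rule M1[OF x(2), of Beta])
            \<comment> \<open>The letter behind the second x is x or y, since anything else would be
              a \<beta>; so the new \<beta> violates no rule and is the only one.\<close>
            show "completed m (e(csuc m x := Beta))"
              using completed_csuc[OF e csuc_in[OF x1]] ex noB[OF csuc_in[OF csuc_in[OF x1]]]
              by (intro completed_upd[OF e m2 x1]) auto
            show "odd (card (occ m (e(csuc m x := Beta)) Beta))"
              using none by (simp add: occ_upd[OF csuc_in[OF x1]])
          qed simp
        next
          case False
          \<comment> \<open>Both \<beta> and y force \<alpha> as the next letter, so any \<beta> may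
            become y; this makes the number of \<beta> odd.\<close>
          have exc: "exceptional m X (insert z Y)" if z: "z \<in> occ m e Beta" for z
          proof -
            have z1: "z \<in> {1..m}" "e z = Beta" using z by (auto simp: occ_def)
            obtain k where k: "k \<in> {1..m}" "z = csuc m k" using csuc_surj[OF z1(1)] .
            show ?thesis
            proof (rule M2[OF z1(1)])
              show "completed m (e(z := Ly))"
                using completed_csuc[OF e z1(1)] z1(2) unfolding k(2)
                by (intro completed_upd[OF e m2 k(1)]) auto
              have "card (occ m e Beta) = Suc (card (occ m e Beta - {z}))"
                by (rule card.remove[OF finite_occ z])
              then show "odd (card (occ m (e(z := Ly)) Beta))"
                using even by (simp add: occ_upd[OF z1(1)])
            qed (simp add: z1)
          qed
          obtain z where z: "z \<in> occ m e Beta" using False by blast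
          obtain h where h: "{1..m} - (X \<union> insert z Y) = {h}"
            using exceptional_props(3)[OF exc[OF z] m] by blast
          \<comment> \<open>Every \<beta> is at z or at the free position h. Their number is even
            and not 0, so both positions carry \<beta>.\<close>
          have "occ m e Beta \<inter> (X \<union> Y) = {}" by (auto simp: X Y occ_def)
          moreover have "occ m e Beta \<subseteq> {1..m}" by (auto simp: occ_def)
          ultimately have "occ m e Beta \<subseteq> {z, h}" using h by blast
          moreover have "occ m e Beta \<noteq> {z}" using even by auto
          ultimately have h': "h \<in> occ m e Beta" using z by blast
          have zh: "z \<in> {1..m}" "h \<in> {1..m}" "e z = Beta" "e h = Beta" using z h' by (auto simp: occ_def)
          \<comment> \<open>No \<beta> follows y or \<beta>, and exceptionality of the pairs
            obtained from z and from h excludes a following y. Thus |Y| + 2 positions have their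
            successors in X, which has only |Y| + 1 elements.\<close>
          have "csuc m ` (Y \<union> {z, h}) \<subseteq> X"
          proof (intro image_subsetI)
            fix w assume w: "w \<in> Y \<union> {z, h}"
            then have w1: "w \<in> {1..m}" using XY zh by blast
            have "e w \<in> {Ly, Beta}" using w letter[OF w1] zh by blast
            then have "e (csuc m w) \<noteq> Beta"
              using completed_csuc[OF e w1] by auto
            then have "csuc m w \<notin> {z, h}" using zh by auto
            moreover have "csuc m w \<notin> Y"
              using w exceptional_props(2)[OF exc[OF z] m, of w] exceptional_props(2)[OF exc[OF h'] m, of w]
              by blast
            ultimately show "csuc m w \<in> X" using h csuc_in[OF w1] by blast
          qed
          then have "card (Y \<union> {z, h}) \<le> card X"
            using card_inj_on_le[OF inj_on_subset[OF inj_on_csuc, of "Y \<union> {z, h}"]] fin XY zh by blast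
          moreover have "card (Y \<union> {z, h}) = card Y + 2"
          proof -
            have "z \<notin> Y" using letter[OF zh(1)] zh(3) by simp
            moreover have "h \<notin> Y" "h \<noteq> z" using h by blast+
            ultimately show ?thesis using fin by simp
          qed
          ultimately show False using card by simp
        qed
      qed
    qed
  qed
qed

section \<open>From blocks to self-duality\<close>

theorem proposition3p47:
  fixes m i :: nat and b :: "nat + nat \<Rightarrow> nat"
  assumes "odd m" and "m \<ge> 3" and "i \<in> {1, 2}"
    and "bij_betw b (base_set m) {1..2 * m}"
  shows "self_dual (2 * m) (boolean_function b (S_system m i))"
  unfolding self_dual_def
proof
  note m = assms(1,2)
  fix a
  define T where "T = {s \<in> base_set m. a (b s)}"
  let ?T' = "base_set m - T"
  have T: "T \<subseteq> base_set m" by (auto simp: T_def)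
  have fin: "finite (base_set m)" by (simp add: base_set_def)
  \<comment> \<open>The restricted function \<open>complement_tuple\<close> negates the entries only
    on this range.\<close>
  have "b s \<in> {1..2 * m}" if "s \<in> base_set m" for s
    using assms(4) that unfolding bij_betw_def by blast
  then have c: "complement_tuple (2 * m) a (b s) \<longleftrightarrow> s \<in> ?T'" if "s \<in> base_set m" for s
    using that unfolding complement_tuple_def T_def by simp
  have S: "S \<subseteq> base_set m" "card S = m" if "S \<in> S_system m i" for S
    using S_system_block[OF m(1) that] by auto
  have f: "boolean_function b (S_system m i) a \<longleftrightarrow> (\<exists>S\<in>S_system m i. S \<subseteq> T)"
    unfolding boolean_function_def T_def using S(1) by blast
  have f': "boolean_function b (S_system m i) (complement_tuple (2 * m) a) \<longleftrightarrow>
      (\<exists>S\<in>S_system m i. S \<subseteq> ?T')"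
    unfolding boolean_function_def
  proof (rule bex_cong[OF refl])
    fix S assume "S \<in> S_system m i"
    then have "S \<subseteq> base_set m" by (rule S(1))
    then show "(\<forall>s\<in>S. complement_tuple (2 * m) a (b s)) \<longleftrightarrow> S \<subseteq> ?T'"
      using c by (metis subset_iff)
  qed
  have cE: "card (base_set m) = 2 * m" by (simp add: base_set_def card_Plus)
  have cT: "card ?T' = 2 * m - card T" "card T \<le> 2 * m"
    using card_Diff_subset[of T "base_set m"] card_mono[OF fin T] finite_subset[OF T fin] T cE by auto
  have big: "\<exists>S\<in>S_system m i. S \<subseteq> U" if U: "U \<subseteq> base_set m" "card U > m" for U
  proof -
    obtain V where "V \<subseteq> U" "card V = Suc m"
      using obtain_subset_with_card_n[of "Suc m" U] U(2) by (metis Suc_leI)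
    then show ?thesis using S_system_block_in_Suc[OF m, of V i] U(1) by (meson subset_trans)
  qed
  \<comment> \<open>Disjoint blocks of size m in a set of size 2m are complements of each
    other.\<close>
  have "False" if "S \<in> S_system m i" "S \<subseteq> T" "R \<in> S_system m i" "R \<subseteq> ?T'" for S R
  proof -
    have "R \<subseteq> base_set m - S" using that by blast
    moreover have "card (base_set m - S) = card R"
      using S[OF that(1)] S[OF that(3)] cE card_Diff_subset[of S "base_set m"] finite_subset[OF _ fin] by simp
    ultimately have "R = base_set m - S" using fin by (simp add: card_subset_eq)
    then show False using S_system_complement[OF m S[OF that(1)]] that by blast
  qed
  \<comment> \<open>If T does not have exactly m elements, then T or its complement has more than
    m.\<close>
  moreover have "(\<exists>S\<in>S_system m i. S \<subseteq> T) \<or> (\<exists>S\<in>S_system m i. S \<subseteq> ?T')"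
  proof (cases "card T = m")
    case True
    then show ?thesis using S_system_complement[OF m T] by blast
  next
    case False
    then show ?thesis using big[OF T] big[of ?T'] cT by fastforce
  qed
  ultimately show "boolean_function b (S_system m i) a =
      (\<not> boolean_function b (S_system m i) (complement_tuple (2 * m) a))"
    unfolding f f' by blast
qed

end
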